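(* Let $\Pi$ be the Fano plane (the projective plane of order $2$), let $(x,M)$ be an anti-flag of $\Pi$ (a point $x$ and a line $M$ with $x$ not incident with $M$), and let $\alpha$ be an automorphism of $\Pi$ of order $3$ which fixes $x$ and $M$ and fixes no other point and no other line. Let $\mathcal{C}_0$ be the point-line geometry obtained from $\Pi$ by removing $M$ and all points incident with $M$, and let $\alpha_0$ be the automorphism of $\mathcal{C}_0$ induced by $\alpha$. Let $\overline{\mathcal{C}}$ be the free completion of $\mathcal{C}_0$ and $\overline{\alpha}$ the automorphism of $\overline{\mathcal{C}}$ obtained by naturally extending $\alpha_0$ through the free construction. Then $\overline{\alpha}$ induces a nontrivial permutation of the set of lines of $\overline{\mathcal{C}}$ incident with $x$, and there is no line $U$ of $\overline{\mathcal{C}}$ not incident with $x$ together with an automorphism $\gamma$ of $\overline{\mathcal{C}}$ fixing $U$ and $x$ such that $\gamma$ and $\overline{\alpha}$ induce the same permutation on the lines incident with $x$.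
   Context: Free completion: given a partial plane $\mathcal{C}_0$ (a point-line geometry in which two points lie on at most one common line), define $\mathcal{C}_1$ by adding, for each pair of distinct lines of $\mathcal{C}_0$ not meeting in a point, a new point incident with exactly these two lines; define $\mathcal{C}_2$ by adding, for each pair of distinct points of $\mathcal{C}_1$ not on a common line, a new line incident with exactly these two points; and continue alternately. The free completion is $\overline{\mathcal{C}} = \bigcup_{i\in\mathbb{N}} \mathcal{C}_i$, a projective plane. An automorphism $\alpha_0$ of $\mathcal{C}_0$ extends step by step to automorphisms $\alpha_i$ of $\mathcal{C}_i$ (a new element added for a pair is sent to the new element added for the image pair), and $\overline{\alpha}$ is the union of the $\alpha_i$. In the terminology of the paper, the permutation induced on lines through $x$ is an automorphism of the "projective type line" $(\overline{\mathcal{C}},x)$, and the conclusion says it is not inherited from any automorphism of an "affine type line" $(\overline{\mathcal{C}}_U,x)$, where $\overline{\mathcal{C}}_U$ is the affine plane obtained by deleting $U$ and its points. *)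

theory Defs
  imports Main "HOL-Library.Uprod"
begin

record ('p, 'l) geometry =
  Points :: "'p set"
  Lines :: "'l set"
  Inc :: "('p \<times> 'l) set"

definition pencil :: "('p, 'l) geometry \<Rightarrow> 'p \<Rightarrow> 'l set" where
  "pencil G p = {l \<in> Lines G. (p, l) \<in> Inc G}"

definition projective_plane :: "('p, 'l) geometry \<Rightarrow> bool" where
  "projective_plane G \<longleftrightarrow>
     Inc G \<subseteq> Points G \<times> Lines G \<and>
     (\<forall>p \<in> Points G. \<forall>q \<in> Points G. p \<noteq> q \<longrightarrow>
        (\<exists>!l. l \<in> Lines G \<and> (p, l) \<in> Inc G \<and> (q, l) \<in> Inc G)) \<and>
     (\<forall>l \<in> Lines G. \<forall>m \<in> Lines G. l \<noteq> m \<longrightarrow>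
        (\<exists>!p. p \<in> Points G \<and> (p, l) \<in> Inc G \<and> (p, m) \<in> Inc G)) \<and>
     (\<exists>Q \<subseteq> Points G. card Q = 4 \<and>
        (\<forall>l \<in> Lines G. card {p \<in> Q. (p, l) \<in> Inc G} \<le> 2))"

definition projective_plane_of_order :: "('p, 'l) geometry \<Rightarrow> nat \<Rightarrow> bool" where
  "projective_plane_of_order G n \<longleftrightarrow>
     projective_plane G \<and> (\<forall>l \<in> Lines G. card {p \<in> Points G. (p, l) \<in> Inc G} = n + 1)"

text \<open>
  An automorphism is given by its actions on points and on lines. Values outside
  \<^term>\<open>Points G\<close> and \<^term>\<open>Lines G\<close> are irrelevant.
\<close>

definition automorphism :: "('p, 'l) geometry \<Rightarrow> ('p \<Rightarrow> 'p) \<Rightarrow> ('l \<Rightarrow> 'l) \<Rightarrow> bool" where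
  "automorphism G f g \<longleftrightarrow>
     bij_betw f (Points G) (Points G) \<and> bij_betw g (Lines G) (Lines G) \<and>
     (\<forall>p \<in> Points G. \<forall>l \<in> Lines G. (f p, g l) \<in> Inc G \<longleftrightarrow> (p, l) \<in> Inc G)"

definition is_identity :: "('p, 'l) geometry \<Rightarrow> ('p \<Rightarrow> 'p) \<Rightarrow> ('l \<Rightarrow> 'l) \<Rightarrow> bool" where
  "is_identity G f g \<longleftrightarrow> (\<forall>p \<in> Points G. f p = p) \<and> (\<forall>l \<in> Lines G. g l = l)"

definition has_order :: "('p, 'l) geometry \<Rightarrow> ('p \<Rightarrow> 'p) \<Rightarrow> ('l \<Rightarrow> 'l) \<Rightarrow> nat \<Rightarrow> bool" where
  "has_order G f g n \<longleftrightarrow>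
     n > 0 \<and> is_identity G (f ^^ n) (g ^^ n) \<and>
     (\<forall>m. 0 < m \<and> m < n \<longrightarrow> \<not> is_identity G (f ^^ m) (g ^^ m))"

definition delete_line :: "('p, 'l) geometry \<Rightarrow> 'l \<Rightarrow> ('p, 'l) geometry" where
  "delete_line G M =
     (let P = {p \<in> Points G. (p, M) \<notin> Inc G}; L = Lines G - {M}
      in \<lparr>Points = P, Lines = L, Inc = Inc G \<inter> (P \<times> L)\<rparr>)"

text \<open>
  The elements of the free completion are formal expressions: an element added for
  an unordered pair is labelled by that pair. A label \<^term>\<open>Meet (Upair l m)\<close>
  is only added while \<^term>\<open>l\<close> and \<^term>\<open>m\<close> have no common point, so it is never
  already in use (dually for \<^term>\<open>Join (Upair p q)\<close>).
\<close>

datatype ('p, 'l) free_point = Point 'p | Meet "('p, 'l) free_line uprod"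
  and ('p, 'l) free_line = Line 'l | Join "('p, 'l) free_point uprod"

definition embed :: "('p, 'l) geometry \<Rightarrow> (('p, 'l) free_point, ('p, 'l) free_line) geometry" where
  "embed G = \<lparr>Points = Point ` Points G, Lines = Line ` Lines G,
              Inc = map_prod Point Line ` Inc G\<rparr>"

definition add_points ::
  "(('p, 'l) free_point, ('p, 'l) free_line) geometry \<Rightarrow>
   (('p, 'l) free_point, ('p, 'l) free_line) geometry" where
  "add_points G =
     (let N = {(l, m). l \<in> Lines G \<and> m \<in> Lines G \<and> l \<noteq> m \<and>
                 \<not> (\<exists>p \<in> Points G. (p, l) \<in> Inc G \<and> (p, m) \<in> Inc G)}
      in \<lparr>Points = Points G \<union> {Meet (Upair l m) |l m. (l, m) \<in> N},
          Lines = Lines G,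
          Inc = Inc G \<union> {(Meet (Upair l m), k) |l m k. (l, m) \<in> N \<and> (k = l \<or> k = m)}\<rparr>)"

definition add_lines ::
  "(('p, 'l) free_point, ('p, 'l) free_line) geometry \<Rightarrow>
   (('p, 'l) free_point, ('p, 'l) free_line) geometry" where
  "add_lines G =
     (let N = {(p, q). p \<in> Points G \<and> q \<in> Points G \<and> p \<noteq> q \<and>
                 \<not> (\<exists>l \<in> Lines G. (p, l) \<in> Inc G \<and> (q, l) \<in> Inc G)}
      in \<lparr>Points = Points G,
          Lines = Lines G \<union> {Join (Upair p q) |p q. (p, q) \<in> N},
          Inc = Inc G \<union> {(r, Join (Upair p q)) |p q r. (p, q) \<in> N \<and> (r = p \<or> r = q)}\<rparr>)"

fun free_stage ::
  "('p, 'l) geometry \<Rightarrow> nat \<Rightarrow> (('p, 'l) free_point, ('p, 'l) free_line) geometry" where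
  "free_stage G 0 = embed G"
| "free_stage G (Suc i) =
     (if even i then add_points (free_stage G i) else add_lines (free_stage G i))"

definition free_completion ::
  "('p, 'l) geometry \<Rightarrow> (('p, 'l) free_point, ('p, 'l) free_line) geometry" where
  "free_completion G = \<lparr>Points = (\<Union>i. Points (free_stage G i)),
                        Lines = (\<Union>i. Lines (free_stage G i)),
                        Inc = (\<Union>i. Inc (free_stage G i))\<rparr>"

text \<open>
  The extension of an automorphism \<^term>\<open>(f, g)\<close> to the free completion: the element
  added for a pair is sent to the element added for the image pair.
\<close>

primrec extend_point :: "('p \<Rightarrow> 'p) \<Rightarrow> ('l \<Rightarrow> 'l) \<Rightarrow> ('p, 'l) free_point \<Rightarrow> ('p, 'l) free_point"
  and extend_line :: "('p \<Rightarrow> 'p) \<Rightarrow> ('l \<Rightarrow> 'l) \<Rightarrow> ('p, 'l) free_line \<Rightarrow> ('p, 'l) free_line" where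
  "extend_point f g (Point p) = Point (f p)"
| "extend_point f g (Meet u) = Meet (map_uprod (extend_line f g) u)"
| "extend_line f g (Line l) = Line (g l)"
| "extend_line f g (Join u) = Join (map_uprod (extend_point f g) u)"

end

theory Submission
  imports Defs
begin

text \<open>
  In a free completion, an element added at a positive stage is incident with exactly two earlier
  elements, and the lines of the affine plane of order 2 carry only two points. Hence the
  completion contains no confined configuration, that is, no nonempty finite set of points and lines
  each incident with at least three others of the set. A nontrivial collineation fixing all lines
  through a point would produce a Desargues configuration, which is confined; so such a
  collineation is trivial. If \<open>\<gamma>\<close> agrees with the extension of \<open>\<alpha>\<close> on the lines through \<open>x\<close>, the
  two are therefore equal, and \<open>U\<close> is fixed by the extension of \<open>\<alpha>\<close>. But the latter has order 3,
  so a fixed element other than \<open>x\<close> would be labelled by a pair of fixed elements, and descending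
  through the stages would give a fixed line, or a fixed point other than \<open>x\<close>, of the affine plane.
\<close>

section \<open>Projective planes without confined configurations\<close>

text \<open>A collineation fixing every line through \<open>x\<close> carries a triangle to one in
  perspective with it from \<open>x\<close>, and each side avoiding \<open>x\<close> meets its image
  in a fixed point. The axis is built from such meets. The obstacle is degeneracy: the axis may pass
  through the centre, and three moved vertices on three different lines through \<open>x\<close>
  have to be found. The vertices come from infinitude: a moved line has at most one fixed point,
  while every line of the completion is infinite, because a finite projective plane would itself be
  a confined configuration. Order 2 of the plane enters because deleting \<open>M\<close> takes one
  of the three points from every other line. Order 3 of the automorphism also supplies its inverse,
  namely its square, so comparing it with \<open>\<gamma>\<close> amounts to composing maps already
  at hand.\<close>

definition row :: "('p, 'l) geometry \<Rightarrow> 'l \<Rightarrow> 'p set" where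
  "row G l = {p \<in> Points G. (p, l) \<in> Inc G}"

definition confined :: "('p, 'l) geometry \<Rightarrow> 'p set \<Rightarrow> 'l set \<Rightarrow> bool" where
  "confined G P L \<longleftrightarrow> finite P \<and> finite L \<and> P \<subseteq> Points G \<and> L \<subseteq> Lines G \<and>
     (\<forall>p \<in> P. 3 \<le> card {l \<in> L. (p, l) \<in> Inc G}) \<and>
     (\<forall>l \<in> L. 3 \<le> card {p \<in> P. (p, l) \<in> Inc G})"

lemma card_ge_3I:
  assumes "finite A" "a \<in> A" "b \<in> A" "c \<in> A" "a \<noteq> b" "a \<noteq> c" "b \<noteq> c"
  shows "3 \<le> card A"
proof -
  have "card {a, b, c} \<le> card A" using assms by (intro card_mono) auto
  then show ?thesis using assms by simp
qed

text \<open>The premise is an implication because \<open>card\<close> of an infinite set is 0. In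
  this form the lemma serves finite and infinite rows and pencils alike.\<close>

lemma ex_not_mem_of_card:
  assumes "finite A \<Longrightarrow> 3 \<le> card A"
  shows "\<exists>c \<in> A. c \<noteq> a \<and> c \<noteq> b"
proof (rule ccontr)
  assume "\<not> ?thesis"
  then have sub: "A \<subseteq> {a, b}" by blast
  then have "finite A" by (rule finite_subset) simp
  moreover have "card A \<le> card {a, b}" using sub by (intro card_mono) auto
  moreover have "card {a, b} \<le> 2" by (simp add: card_insert_if)
  ultimately show False using assms by linarith
qed

section \<open>Counting points and lines in a projective plane\<close>

locale plane =
  fixes G :: "('p, 'l) geometry"
  assumes projective: "projective_plane G"
begin

lemma Inc_subset: "Inc G \<subseteq> Points G \<times> Lines G"
  and ex1_join: "\<forall>p \<in> Points G. \<forall>q \<in> Points G. p \<noteq> q \<longrightarrow>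
        (\<exists>!l. l \<in> Lines G \<and> (p, l) \<in> Inc G \<and> (q, l) \<in> Inc G)"
  and ex1_meet: "\<forall>l \<in> Lines G. \<forall>m \<in> Lines G. l \<noteq> m \<longrightarrow>
        (\<exists>!p. p \<in> Points G \<and> (p, l) \<in> Inc G \<and> (p, m) \<in> Inc G)"
  and ex_quadrangle: "\<exists>Q \<subseteq> Points G. card Q = 4 \<and>
        (\<forall>l \<in> Lines G. card {p \<in> Q. (p, l) \<in> Inc G} \<le> 2)"
  using projective unfolding projective_plane_def by argo+

lemma Inc_PointsD: "(p, l) \<in> Inc G \<Longrightarrow> p \<in> Points G"
  and Inc_LinesD: "(p, l) \<in> Inc G \<Longrightarrow> l \<in> Lines G"
  using Inc_subset by blast+

lemma join_exists:
  assumes "p \<in> Points G" "q \<in> Points G" "p \<noteq> q"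
  obtains l where "(p, l) \<in> Inc G" "(q, l) \<in> Inc G"
  using ex1_join[rule_format, OF assms] by (auto elim: ex1E)

lemma meet_exists:
  assumes "l \<in> Lines G" "m \<in> Lines G" "l \<noteq> m"
  obtains p where "(p, l) \<in> Inc G" "(p, m) \<in> Inc G"
  using ex1_meet[rule_format, OF assms] by (auto elim: ex1E)

lemma join_unique:
  assumes "(p, l) \<in> Inc G" "(q, l) \<in> Inc G" "(p, m) \<in> Inc G" "(q, m) \<in> Inc G" "p \<noteq> q"
  shows "l = m"
  using ex1_join[rule_format, OF Inc_PointsD[OF assms(1)] Inc_PointsD[OF assms(2)] assms(5)]
    assms Inc_LinesD by blast

text \<open>The perspectivity from \<open>z\<close>: a point of \<open>V\<close> goes to its join
  with \<open>z\<close>. Finiteness and cardinality are extracted from it separately, since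
  \<open>card\<close> alone does not detect infinite sets.\<close>

lemma pencil_row_bij:
  assumes "z \<in> Points G" "V \<in> Lines G" "(z, V) \<notin> Inc G"
  shows "\<exists>h. bij_betw h (row G V) (pencil G z)"
proof -
  have "\<exists>l. (z, l) \<in> Inc G \<and> (p, l) \<in> Inc G" if "p \<in> row G V" for p
    using that assms join_exists[of z p] unfolding row_def by blast
  then obtain h where h: "\<And>p. p \<in> row G V \<Longrightarrow> (z, h p) \<in> Inc G \<and> (p, h p) \<in> Inc G"
    by metis
  have "inj_on h (row G V)"
  proof (rule inj_onI, rule ccontr)
    fix p q assume pq: "p \<in> row G V" "q \<in> row G V" "h p = h q" "p \<noteq> q"
    then have "h p = V"
      using h[OF pq(1)] h[OF pq(2)] join_unique[of p "h p" q V] by (simp add: row_def)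
    then show False using h pq(1) assms(3) by metis
  qed
  moreover have "h ` row G V = pencil G z"
  proof
    show "h ` row G V \<subseteq> pencil G z" using h Inc_LinesD by (auto simp: pencil_def)
    show "pencil G z \<subseteq> h ` row G V"
    proof
      fix l assume "l \<in> pencil G z"
      then have l: "l \<in> Lines G" "(z, l) \<in> Inc G" by (auto simp: pencil_def)
      then have "l \<noteq> V" using assms(3) by auto
      then obtain p where p: "(p, l) \<in> Inc G" "(p, V) \<in> Inc G"
        using l(1) assms(2) meet_exists by blast
      then have row: "p \<in> row G V" using Inc_PointsD by (auto simp: row_def)
      have "z \<noteq> p" using p assms(3) by auto
      then have "h p = l" using join_unique[of z "h p" p l] h[OF row] l p by blast
      then show "l \<in> h ` row G V" using row by blast
    qed
  qed
  ultimately show ?thesis unfolding bij_betw_def by blast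
qed

lemma finite_row_iff_finite_pencil:
  assumes "z \<in> Points G" "V \<in> Lines G" "(z, V) \<notin> Inc G"
  shows "finite (row G V) \<longleftrightarrow> finite (pencil G z)"
  using pencil_row_bij[OF assms] bij_betw_finite by blast

lemma card_row_eq_card_pencil:
  assumes "z \<in> Points G" "V \<in> Lines G" "(z, V) \<notin> Inc G"
  shows "card (row G V) = card (pencil G z)"
  using pencil_row_bij[OF assms] bij_betw_same_card by blast

lemma quadrangle:
  obtains Q where "Q \<subseteq> Points G" "card Q = 4"
    "\<forall>l \<in> Lines G. card {p \<in> Q. (p, l) \<in> Inc G} \<le> 2"
  using ex_quadrangle by auto

text \<open>No three of the four points are collinear, so the joins of \<open>q\<close> to the other
  three are distinct.\<close>

lemma card_pencil_quadrangle:
  assumes Q: "Q \<subseteq> Points G" "card Q = 4"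
      "\<forall>l \<in> Lines G. card {p \<in> Q. (p, l) \<in> Inc G} \<le> 2"
    and q: "q \<in> Q" and fin: "finite (pencil G q)"
  shows "3 \<le> card (pencil G q)"
proof -
  have finQ: "finite Q" using Q(2) card.infinite by fastforce
  have "\<exists>l. (q, l) \<in> Inc G \<and> (p, l) \<in> Inc G" if "p \<in> Q - {q}" for p
    using that q Q(1) join_exists[of q p] by blast
  then obtain h where h: "\<And>p. p \<in> Q - {q} \<Longrightarrow> (q, h p) \<in> Inc G \<and> (p, h p) \<in> Inc G"
    by metis
  have "inj_on h (Q - {q})"
  proof (rule inj_onI, rule ccontr)
    fix p r assume pr: "p \<in> Q - {q}" "r \<in> Q - {q}" "h p = h r" "p \<noteq> r"
    have "3 \<le> card {s \<in> Q. (s, h p) \<in> Inc G}"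
      by (rule card_ge_3I[of _ q p r]) (use pr h[OF pr(1)] h[OF pr(2)] q finQ in auto)
    moreover have "card {s \<in> Q. (s, h p) \<in> Inc G} \<le> 2"
      using h[OF pr(1)] Inc_LinesD Q(3) by blast
    ultimately show False by simp
  qed
  moreover have "h ` (Q - {q}) \<subseteq> pencil G q" using h Inc_LinesD by (auto simp: pencil_def)
  ultimately have "card (Q - {q}) \<le> card (pencil G q)" using fin card_inj_on_le by blast
  then show ?thesis using Q(2) q finQ by simp
qed

text \<open>A line misses some point of the quadrangle, and these are the points whose pencils are
  already known to be large. Perspectivity then spreads the bound to all rows, and from rows to all
  pencils.\<close>

lemma ex_point_off_line:
  assumes "V \<in> Lines G"
  obtains z where "z \<in> Points G" "(z, V) \<notin> Inc G" "finite (pencil G z) \<Longrightarrow> 3 \<le> card (pencil G z)"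
proof -
  obtain Q where Q: "Q \<subseteq> Points G" "card Q = 4"
    "\<forall>l \<in> Lines G. card {p \<in> Q. (p, l) \<in> Inc G} \<le> 2" by (rule quadrangle)
  have "{p \<in> Q. (p, V) \<in> Inc G} \<noteq> Q" using Q(2) bspec[OF Q(3) assms] by auto
  then obtain z where "z \<in> Q" "(z, V) \<notin> Inc G" by blast
  then show thesis using that card_pencil_quadrangle[OF Q] Q(1) by blast
qed

lemma card_row_ge_3:
  assumes "V \<in> Lines G" "finite (row G V)"
  shows "3 \<le> card (row G V)"
proof -
  obtain z where "z \<in> Points G" "(z, V) \<notin> Inc G" "finite (pencil G z) \<Longrightarrow> 3 \<le> card (pencil G z)"
    using ex_point_off_line assms(1) by metis
  then show ?thesis
    using assms card_row_eq_card_pencil finite_row_iff_finite_pencil by metis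
qed

text \<open>Through a quadrangle point \<open>q\<close> other than \<open>z\<close>, any line
  different from the join of \<open>q\<close> and \<open>z\<close> will do.\<close>

lemma ex_line_off_point:
  assumes "z \<in> Points G"
  obtains V where "V \<in> Lines G" "(z, V) \<notin> Inc G"
proof -
  obtain Q where Q: "Q \<subseteq> Points G" "card Q = 4"
    "\<forall>l \<in> Lines G. card {p \<in> Q. (p, l) \<in> Inc G} \<le> 2" by (rule quadrangle)
  obtain q where q: "q \<in> Q" "q \<noteq> z"
    using ex_not_mem_of_card[of Q z z] Q(2) by auto
  then obtain k where k: "(z, k) \<in> Inc G" "(q, k) \<in> Inc G"
    using assms Q(1) join_exists[of z q] by blast
  obtain l where "l \<in> pencil G q" "l \<noteq> k"
    using ex_not_mem_of_card[of "pencil G q" k k] card_pencil_quadrangle[OF Q q(1)] by blast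
  then have "l \<in> Lines G" "(z, l) \<notin> Inc G"
    using k q(2) join_unique by (auto simp: pencil_def)
  then show thesis by (rule that)
qed

lemma card_pencil_ge_3:
  assumes "z \<in> Points G" "finite (pencil G z)"
  shows "3 \<le> card (pencil G z)"
proof -
  obtain V where "V \<in> Lines G" "(z, V) \<notin> Inc G"
    using ex_line_off_point[OF assms(1)] by blast
  then show ?thesis
    using assms card_row_ge_3 card_row_eq_card_pencil finite_row_iff_finite_pencil by metis
qed

text \<open>Both pencils are in perspective with one line \<open>V\<close> avoiding both points; it
  is drawn through a third point of the join of \<open>w\<close> and \<open>z\<close>.\<close>

lemma finite_pencil_transfer:
  assumes z: "z \<in> Points G" "finite (pencil G z)" and w: "w \<in> Points G"
  shows "finite (pencil G w)"
proof (cases "w = z")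
  case False
  then obtain k where k: "(w, k) \<in> Inc G" "(z, k) \<in> Inc G"
    using w z join_exists by blast
  obtain p where p: "p \<in> row G k" "p \<noteq> w" "p \<noteq> z"
    using ex_not_mem_of_card[of "row G k" w z] card_row_ge_3[of k] k(1) Inc_LinesD by blast
  then obtain V where V: "V \<in> pencil G p" "V \<noteq> k"
    using ex_not_mem_of_card[of "pencil G p" k k] card_pencil_ge_3[of p] by (auto simp: row_def)
  have "V \<in> Lines G" "(w, V) \<notin> Inc G" "(z, V) \<notin> Inc G"
    using V p k join_unique by (auto simp: pencil_def row_def)
  then show ?thesis using z w finite_row_iff_finite_pencil by metis
qed (use z in simp)

end

locale unconfined_plane = plane +
  assumes unconfined: "confined G P L \<Longrightarrow> P = {}"
begin

text \<open>One finite pencil makes every pencil and every row finite, hence the whole plane. Then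
  all points and lines together are confined, as pencils and rows have at least three
  elements.\<close>

lemma infinite_pencil:
  assumes z: "z \<in> Points G"
  shows "infinite (pencil G z)"
proof
  assume fin: "finite (pencil G z)"
  have pencils: "finite (pencil G w)" if "w \<in> Points G" for w
    using finite_pencil_transfer z fin that by blast
  have rows: "finite (row G V)" if "V \<in> Lines G" for V
    using that ex_point_off_line[OF that] pencils finite_row_iff_finite_pencil by metis
  have "Points G \<subseteq> insert z (\<Union>l \<in> pencil G z. row G l)"
  proof
    fix p assume p: "p \<in> Points G"
    show "p \<in> insert z (\<Union>l \<in> pencil G z. row G l)"
    proof (cases "p = z")
      case False
      then obtain l where "(z, l) \<in> Inc G" "(p, l) \<in> Inc G" using p z join_exists by metis
      then show ?thesis using p Inc_LinesD by (auto simp: pencil_def row_def)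
    qed simp
  qed
  then have finP: "finite (Points G)"
    by (rule finite_subset) (use fin rows in \<open>auto simp: pencil_def\<close>)
  obtain V where V: "V \<in> Lines G" using ex_line_off_point[OF z] by blast
  have "Lines G \<subseteq> insert V (\<Union>p \<in> row G V. pencil G p)"
  proof
    fix l assume l: "l \<in> Lines G"
    show "l \<in> insert V (\<Union>p \<in> row G V. pencil G p)"
    proof (cases "l = V")
      case False
      then obtain p where "(p, l) \<in> Inc G" "(p, V) \<in> Inc G" using l V meet_exists by metis
      then show ?thesis using l Inc_PointsD by (auto simp: pencil_def row_def)
    qed simp
  qed
  then have "finite (Lines G)"
    by (rule finite_subset) (use V pencils rows in \<open>auto simp: row_def\<close>)
  then have "confined G (Points G) (Lines G)"
    using finP card_pencil_ge_3 card_row_ge_3 pencils rows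
    by (simp add: confined_def pencil_def row_def)
  then show False using unconfined z by blast
qed

lemma infinite_row:
  assumes "V \<in> Lines G"
  shows "infinite (row G V)"
  using ex_point_off_line[OF assms] infinite_pencil finite_row_iff_finite_pencil assms by metis

end

section \<open>Central collineations\<close>

text \<open>No axis is assumed and the identity is allowed; the axis is recovered from fixed points
  where it is needed.\<close>

locale central_collineation = plane +
  fixes f :: "'a \<Rightarrow> 'a" and g :: "'b \<Rightarrow> 'b" and x :: 'a
  assumes collineation: "automorphism G f g"
    and centre: "x \<in> Points G" "f x = x"
    and central: "\<And>l. (x, l) \<in> Inc G \<Longrightarrow> g l = l"
begin

lemma image_Inc: "(p, l) \<in> Inc G \<Longrightarrow> (f p, g l) \<in> Inc G"
  using collineation Inc_PointsD Inc_LinesD by (auto simp: automorphism_def)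

lemma image_Inc_iff: "p \<in> Points G \<Longrightarrow> l \<in> Lines G \<Longrightarrow> (f p, g l) \<in> Inc G \<longleftrightarrow> (p, l) \<in> Inc G"
  using collineation by (auto simp: automorphism_def)

lemma image_point_eq_iff: "p \<in> Points G \<Longrightarrow> q \<in> Points G \<Longrightarrow> f p = f q \<longleftrightarrow> p = q"
  using collineation by (auto simp: automorphism_def bij_betw_def inj_on_def)

lemma image_line_eq_iff: "l \<in> Lines G \<Longrightarrow> m \<in> Lines G \<Longrightarrow> g l = g m \<longleftrightarrow> l = m"
  using collineation by (auto simp: automorphism_def bij_betw_def inj_on_def)

text \<open>If \<open>p\<close> moved, the fixed line through \<open>x\<close> and \<open>p\<close>
  would be the join of \<open>p\<close> and \<open>f p\<close>, which is \<open>g l\<close>. But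
  \<open>g l\<close> avoids \<open>x\<close> because \<open>l\<close> does.\<close>

lemma meet_image_fixed:
  assumes "(x, l) \<notin> Inc G" "(p, l) \<in> Inc G" "(p, g l) \<in> Inc G"
  shows "f p = p"
proof (rule ccontr)
  assume neq: "f p \<noteq> p"
  have "x \<noteq> p" using assms by auto
  then obtain k where k: "(x, k) \<in> Inc G" "(p, k) \<in> Inc G"
    using centre assms(2) Inc_PointsD join_exists by blast
  then have "(f p, k) \<in> Inc G" using image_Inc[of p k] central by simp
  then have "k = g l" using neq k assms(2,3) image_Inc[of p l] join_unique by metis
  then have "(f x, g l) \<in> Inc G" using k centre by simp
  then show False using assms centre image_Inc_iff Inc_LinesD by blast
qed

lemma fixed_line_pointwise:
  assumes "(x, l) \<notin> Inc G" "g l = l" "(p, l) \<in> Inc G"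
  shows "f p = p"
  using meet_image_fixed assms by simp

lemma join_fixed:
  assumes "(p, l) \<in> Inc G" "(q, l) \<in> Inc G" "f p = p" "f q = q" "p \<noteq> q"
  shows "g l = l"
  using image_Inc[OF assms(1)] image_Inc[OF assms(2)] assms join_unique by metis

lemma ex_fixed_point:
  assumes "l \<in> Lines G" "(x, l) \<notin> Inc G" "g l \<noteq> l"
  obtains p where "(p, l) \<in> Inc G" "(p, g l) \<in> Inc G" "f p = p"
proof -
  have "g l \<in> Lines G" using collineation assms(1) by (auto simp: automorphism_def bij_betw_def)
  then show thesis using that assms meet_exists[of l "g l"] meet_image_fixed by metis
qed

text \<open>The line \<open>A\<close> is fixed and avoids \<open>x\<close>, so it is pointwise
  fixed. Its meet with \<open>m\<close> is a fixed point of \<open>m\<close>, and a moved line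
  carries only one of these.\<close>

lemma fixed_point_on_axis:
  assumes A: "(r, A) \<in> Inc G" "(s, A) \<in> Inc G" "f r = r" "f s = s" "r \<noteq> s" "(x, A) \<notin> Inc G"
    and m: "(t, m) \<in> Inc G" "f t = t" "g m \<noteq> m"
  shows "(t, A) \<in> Inc G"
proof -
  have fA: "g A = A" using A join_fixed by blast
  then have "A \<noteq> m" using m by auto
  then obtain y where y: "(y, A) \<in> Inc G" "(y, m) \<in> Inc G"
    using A(1) m(1) Inc_LinesD meet_exists by metis
  then have "f y = y" using fixed_line_pointwise A fA by blast
  then have "y = t" using join_fixed y m by blast
  then show ?thesis using y by simp
qed

text \<open>If the join of \<open>r\<close> with \<open>s\<close> or with \<open>t\<close> avoids
  \<open>x\<close>, it captures the remaining point. Otherwise both joins equal the line through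
  \<open>x\<close> and \<open>r\<close>, which covers an axis passing through the centre.\<close>

lemma fixed_points_collinear:
  assumes r: "(r, l) \<in> Inc G" "f r = r" "(x, l) \<notin> Inc G"
    and s: "(s, m) \<in> Inc G" "f s = s" "g m \<noteq> m"
    and t: "(t, n) \<in> Inc G" "f t = t" "g n \<noteq> n"
    and "r \<noteq> s" "r \<noteq> t"
  obtains A where "(r, A) \<in> Inc G" "(s, A) \<in> Inc G" "(t, A) \<in> Inc G"
proof -
  obtain A where A: "(r, A) \<in> Inc G" "(s, A) \<in> Inc G"
    using join_exists[of r s] assms Inc_PointsD by blast
  obtain B where B: "(r, B) \<in> Inc G" "(t, B) \<in> Inc G"
    using join_exists[of r t] assms Inc_PointsD by blast
  consider "(x, A) \<notin> Inc G" | "(x, B) \<notin> Inc G" | "(x, A) \<in> Inc G" "(x, B) \<in> Inc G" by blast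
  then show thesis
  proof cases
    case 1 then show thesis using that A fixed_point_on_axis[of r A s t n] assms by blast
  next
    case 2 then show thesis using that B fixed_point_on_axis[of r B t s m] assms by blast
  next
    case 3
    have "x \<noteq> r" using r by auto
    then have "A = B" using 3 A B join_unique by metis
    then show thesis using that A B by blast
  qed
qed

text \<open>The triangle and its image are in perspective from \<open>x\<close>, and corresponding
  sides meet in the fixed points \<open>r12\<close>, \<open>r13\<close>, \<open>r23\<close> on the
  axis \<open>A\<close>. Every point and line of the configuration gets three explicit distinct
  incidences, so coincidences among the listed elements would do no harm.\<close>

lemma desargues_confined:
  assumes h: "(x, h1) \<in> Inc G" "(x, h2) \<in> Inc G" "(x, h3) \<in> Inc G"
      "(p1, h1) \<in> Inc G" "(p2, h2) \<in> Inc G" "(p3, h3) \<in> Inc G"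
      "h1 \<noteq> h2" "h1 \<noteq> h3" "h2 \<noteq> h3"
    and p: "f p1 \<noteq> p1" "f p2 \<noteq> p2" "f p3 \<noteq> p3"
    and l: "(p1, l12) \<in> Inc G" "(p2, l12) \<in> Inc G" "(p1, l13) \<in> Inc G" "(p3, l13) \<in> Inc G"
      "(p2, l23) \<in> Inc G" "(p3, l23) \<in> Inc G"
    and noncoll: "l12 \<noteq> l13"
  shows "\<exists>P L. confined G P L \<and> P \<noteq> {}"
proof -
  note [dest] = Inc_PointsD Inc_LinesD
  have xp: "x \<noteq> p1" "x \<noteq> p2" "x \<noteq> p3" using p centre by auto
  have pp: "p1 \<noteq> p2" "p1 \<noteq> p3" "p2 \<noteq> p3" using h xp join_unique by metis+
  have ll: "l12 \<noteq> l23" "l13 \<noteq> l23" using l noncoll pp join_unique by metis+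
  have off: "(x, l12) \<notin> Inc G" "(x, l13) \<notin> Inc G" "(x, l23) \<notin> Inc G"
    using h l xp join_unique by metis+
  \<comment> \<open>A fixed side avoiding \<open>x\<close> would be pointwise fixed, but its
    vertices move.\<close>
  have moved: "g l12 \<noteq> l12" "g l13 \<noteq> l13" "g l23 \<noteq> l23"
    using off p l fixed_line_pointwise by blast+
  obtain r12 where r12: "(r12, l12) \<in> Inc G" "(r12, g l12) \<in> Inc G" "f r12 = r12"
    using ex_fixed_point off moved l by blast
  obtain r13 where r13: "(r13, l13) \<in> Inc G" "(r13, g l13) \<in> Inc G" "f r13 = r13"
    using ex_fixed_point off moved l by blast
  obtain r23 where r23: "(r23, l23) \<in> Inc G" "(r23, g l23) \<in> Inc G" "f r23 = r23"
    using ex_fixed_point off moved l by blast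
  \<comment> \<open>Two sides meet only in a vertex, and vertices move while these three points are
    fixed.\<close>
  have rr: "r12 \<noteq> r13" "r12 \<noteq> r23" "r13 \<noteq> r23"
    using r12 r13 r23 l noncoll ll p join_unique by metis+
  obtain A where A: "(r12, A) \<in> Inc G" "(r13, A) \<in> Inc G" "(r23, A) \<in> Inc G"
    using fixed_points_collinear[of r12 l12 r13 l13 r23 l23] r12 r13 r23 rr off moved by blast
  have fA: "g A = A" using join_fixed A r12 r13 rr by blast
  have Al: "A \<noteq> l12" "A \<noteq> l13" "A \<noteq> l23" using fA moved by auto
  have mem: "x \<in> Points G" "p1 \<in> Points G" "p2 \<in> Points G" "p3 \<in> Points G"
    "h1 \<in> Lines G" "h2 \<in> Lines G" "h3 \<in> Lines G" "A \<in> Lines G"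
    "l12 \<in> Lines G" "l13 \<in> Lines G" "l23 \<in> Lines G"
    "r12 \<in> Points G" "r13 \<in> Points G" "r23 \<in> Points G"
    using h l A by blast+
  have Al': "A \<noteq> g l12" "A \<noteq> g l13" "A \<noteq> g l23"
    using fA Al mem image_line_eq_iff by metis+
  have gh: "g h1 = h1" "g h2 = h2" "g h3 = h3" using h central by auto
  have h': "(f p1, h1) \<in> Inc G" "(f p2, h2) \<in> Inc G" "(f p3, h3) \<in> Inc G"
    using h image_Inc gh by metis+
  have l': "(f p1, g l12) \<in> Inc G" "(f p2, g l12) \<in> Inc G" "(f p1, g l13) \<in> Inc G"
    "(f p3, g l13) \<in> Inc G" "(f p2, g l23) \<in> Inc G" "(f p3, g l23) \<in> Inc G"
    using l image_Inc by blast+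
  have mem': "f p1 \<in> Points G" "f p2 \<in> Points G" "f p3 \<in> Points G"
    "g l12 \<in> Lines G" "g l13 \<in> Lines G" "g l23 \<in> Lines G" using l' by blast+
  have ll': "g l12 \<noteq> g l13" "g l12 \<noteq> g l23" "g l13 \<noteq> g l23"
    using noncoll ll mem image_line_eq_iff by metis+
  have pp': "f p1 \<noteq> f p2" "f p1 \<noteq> f p3" "f p2 \<noteq> f p3"
    using pp mem image_point_eq_iff by metis+
  have xp': "x \<noteq> f p1" "x \<noteq> f p2" "x \<noteq> f p3"
    using xp mem centre image_point_eq_iff by metis+
  have rp: "r12 \<noteq> p1" "r12 \<noteq> p2" "r13 \<noteq> p1" "r13 \<noteq> p3" "r23 \<noteq> p2" "r23 \<noteq> p3"
    using r12 r13 r23 p by auto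
  have rp': "r12 \<noteq> f p1" "r12 \<noteq> f p2" "r13 \<noteq> f p1" "r13 \<noteq> f p3" "r23 \<noteq> f p2" "r23 \<noteq> f p3"
    using rp r12 r13 r23 mem image_point_eq_iff by metis+
  have hl: "h1 \<noteq> l12" "h1 \<noteq> l13" "h2 \<noteq> l12" "h2 \<noteq> l23" "h3 \<noteq> l13" "h3 \<noteq> l23"
    using h off by auto
  have hl': "h1 \<noteq> g l12" "h1 \<noteq> g l13" "h2 \<noteq> g l12" "h2 \<noteq> g l23" "h3 \<noteq> g l13" "h3 \<noteq> g l23"
    using hl gh mem image_line_eq_iff by metis+
  define P where "P = {x, p1, p2, p3, f p1, f p2, f p3, r12, r13, r23}"
  define L where "L = {h1, h2, h3, l12, l13, l23, g l12, g l13, g l23, A}"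
  have fin: "finite P" "finite L" by (simp_all add: P_def L_def)
  have three_lines: "3 \<le> card {l \<in> L. (q, l) \<in> Inc G}"
    if "a \<in> L" "b \<in> L" "c \<in> L" "(q, a) \<in> Inc G" "(q, b) \<in> Inc G" "(q, c) \<in> Inc G"
      "a \<noteq> b" "a \<noteq> c" "b \<noteq> c" for q a b c
    by (rule card_ge_3I[of _ a b c]) (use that fin in auto)
  have three_points: "3 \<le> card {q \<in> P. (q, k) \<in> Inc G}"
    if "a \<in> P" "b \<in> P" "c \<in> P" "(a, k) \<in> Inc G" "(b, k) \<in> Inc G" "(c, k) \<in> Inc G"
      "a \<noteq> b" "a \<noteq> c" "b \<noteq> c" for k a b c
    by (rule card_ge_3I[of _ a b c]) (use that fin in auto)
  have inL: "h1 \<in> L" "h2 \<in> L" "h3 \<in> L" "l12 \<in> L" "l13 \<in> L" "l23 \<in> L"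
    "g l12 \<in> L" "g l13 \<in> L" "g l23 \<in> L" "A \<in> L" by (simp_all add: L_def)
  have inP: "x \<in> P" "p1 \<in> P" "p2 \<in> P" "p3 \<in> P" "f p1 \<in> P" "f p2 \<in> P" "f p3 \<in> P"
    "r12 \<in> P" "r13 \<in> P" "r23 \<in> P" by (simp_all add: P_def)
  have "3 \<le> card {l \<in> L. (q, l) \<in> Inc G}" if "q \<in> P" for q
  proof -
    have "3 \<le> card {l \<in> L. (x, l) \<in> Inc G}"
      by (rule three_lines[of h1 h2 h3]) (use inL h in auto)
    moreover have "3 \<le> card {l \<in> L. (p1, l) \<in> Inc G}"
      by (rule three_lines[of h1 l12 l13]) (use inL h l hl noncoll in auto)
    moreover have "3 \<le> card {l \<in> L. (p2, l) \<in> Inc G}"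
      by (rule three_lines[of h2 l12 l23]) (use inL h l hl ll in auto)
    moreover have "3 \<le> card {l \<in> L. (p3, l) \<in> Inc G}"
      by (rule three_lines[of h3 l13 l23]) (use inL h l hl ll in auto)
    moreover have "3 \<le> card {l \<in> L. (f p1, l) \<in> Inc G}"
      by (rule three_lines[of h1 "g l12" "g l13"]) (use inL h' l' hl' ll' in auto)
    moreover have "3 \<le> card {l \<in> L. (f p2, l) \<in> Inc G}"
      by (rule three_lines[of h2 "g l12" "g l23"]) (use inL h' l' hl' ll' in auto)
    moreover have "3 \<le> card {l \<in> L. (f p3, l) \<in> Inc G}"
      by (rule three_lines[of h3 "g l13" "g l23"]) (use inL h' l' hl' ll' in auto)
    moreover have "3 \<le> card {l \<in> L. (r12, l) \<in> Inc G}"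
      by (rule three_lines[of A l12 "g l12"]) (use inL A r12 Al Al' moved in auto)
    moreover have "3 \<le> card {l \<in> L. (r13, l) \<in> Inc G}"
      by (rule three_lines[of A l13 "g l13"]) (use inL A r13 Al Al' moved in auto)
    moreover have "3 \<le> card {l \<in> L. (r23, l) \<in> Inc G}"
      by (rule three_lines[of A l23 "g l23"]) (use inL A r23 Al Al' moved in auto)
    ultimately show ?thesis using that unfolding P_def by blast
  qed
  moreover have "3 \<le> card {q \<in> P. (q, k) \<in> Inc G}" if "k \<in> L" for k
  proof -
    have "3 \<le> card {q \<in> P. (q, h1) \<in> Inc G}"
      by (rule three_points[of x p1 "f p1"]) (use inP h h' xp xp' p in auto)
    moreover have "3 \<le> card {q \<in> P. (q, h2) \<in> Inc G}"
      by (rule three_points[of x p2 "f p2"]) (use inP h h' xp xp' p in auto)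
    moreover have "3 \<le> card {q \<in> P. (q, h3) \<in> Inc G}"
      by (rule three_points[of x p3 "f p3"]) (use inP h h' xp xp' p in auto)
    moreover have "3 \<le> card {q \<in> P. (q, l12) \<in> Inc G}"
      by (rule three_points[of r12 p1 p2]) (use inP l r12 rp pp in auto)
    moreover have "3 \<le> card {q \<in> P. (q, l13) \<in> Inc G}"
      by (rule three_points[of r13 p1 p3]) (use inP l r13 rp pp in auto)
    moreover have "3 \<le> card {q \<in> P. (q, l23) \<in> Inc G}"
      by (rule three_points[of r23 p2 p3]) (use inP l r23 rp pp in auto)
    moreover have "3 \<le> card {q \<in> P. (q, g l12) \<in> Inc G}"
      by (rule three_points[of r12 "f p1" "f p2"]) (use inP l' r12 rp' pp' in auto)
    moreover have "3 \<le> card {q \<in> P. (q, g l13) \<in> Inc G}"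
      by (rule three_points[of r13 "f p1" "f p3"]) (use inP l' r13 rp' pp' in auto)
    moreover have "3 \<le> card {q \<in> P. (q, g l23) \<in> Inc G}"
      by (rule three_points[of r23 "f p2" "f p3"]) (use inP l' r23 rp' pp' in auto)
    moreover have "3 \<le> card {q \<in> P. (q, A) \<in> Inc G}"
      by (rule three_points[of r12 r13 r23]) (use inP A rr in auto)
    ultimately show ?thesis using that unfolding L_def by blast
  qed
  moreover have "P \<subseteq> Points G" "L \<subseteq> Lines G"
    using mem mem' by (auto simp: P_def L_def)
  ultimately have "confined G P L" using fin by (simp add: confined_def)
  then show ?thesis using inP by blast
qed

end

text \<open>A moved line \<open>U\<close> has room for two moved vertices, and a second moved line
  through one of them supplies the third. Then \<open>desargues_confined\<close> applies.\<close>

lemma (in unconfined_plane) central_collineation_fixes_lines: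
  assumes "central_collineation G f g x" "U \<in> Lines G"
  shows "g U = U"
proof (rule ccontr)
  interpret central_collineation G f g x by fact
  assume moved: "g U \<noteq> U"
  then have xU: "(x, U) \<notin> Inc G" using central by blast
  \<comment> \<open>Two fixed points on a line would fix it, so only one point of the infinite row
    can be fixed.\<close>
  have moved_points_infinite: "infinite {p \<in> row G l. f p \<noteq> p}" if "l \<in> Lines G" "g l \<noteq> l" for l
  proof -
    have "finite {p \<in> row G l. f p = p}"
    proof (cases "\<exists>p \<in> row G l. f p = p")
      case True
      then obtain p where p: "p \<in> row G l" "f p = p" by blast
      then have "{p \<in> row G l. f p = p} \<subseteq> {p}"
        using that join_fixed by (auto simp: row_def)
      then show ?thesis using finite_subset by blast
    next
      case False
      then have "{p \<in> row G l. f p = p} = {}" by blast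
      then show ?thesis by (simp only: finite.emptyI)
    qed
    then have "infinite (row G l - {p \<in> row G l. f p = p})"
      using infinite_row[OF that(1)] by simp
    moreover have "row G l - {p \<in> row G l. f p = p} = {p \<in> row G l. f p \<noteq> p}" by auto
    ultimately show ?thesis by simp
  qed
  obtain p1 where p1: "(p1, U) \<in> Inc G" "f p1 \<noteq> p1"
    using infinite_imp_nonempty[OF moved_points_infinite[OF assms(2) moved]] by (auto simp: row_def)
  have "infinite ({p \<in> row G U. f p \<noteq> p} - {p1})"
    using moved_points_infinite[OF assms(2) moved] by simp
  from infinite_imp_nonempty[OF this]
  obtain p2 where p2: "(p2, U) \<in> Inc G" "f p2 \<noteq> p2" "p2 \<noteq> p1"
    by (auto simp: row_def)
  have xp: "x \<noteq> p1" "x \<noteq> p2" using p1 p2 centre by auto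
  obtain h1 where h1: "(x, h1) \<in> Inc G" "(p1, h1) \<in> Inc G"
    using join_exists[of x p1] xp centre p1 Inc_PointsD by blast
  obtain h2 where h2: "(x, h2) \<in> Inc G" "(p2, h2) \<in> Inc G"
    using join_exists[of x p2] xp centre p2 Inc_PointsD by blast
  have h12: "h1 \<noteq> h2" using h1 h2 p1 p2 xU join_unique by metis
  \<comment> \<open>The second side \<open>V\<close> through \<open>p1\<close> differs from
    \<open>h1\<close>, so it avoids \<open>x\<close>; containing the moved point \<open>p1\<close>,
    it is itself moved.\<close>
  have "infinite (pencil G p1 - {U, h1})"
    using infinite_pencil p1 Inc_PointsD by auto
  from infinite_imp_nonempty[OF this]
  obtain V where V: "(p1, V) \<in> Inc G" "V \<noteq> U" "V \<noteq> h1"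
    by (auto simp: pencil_def)
  have xV: "(x, V) \<notin> Inc G" using V h1 xp join_unique by metis
  have gV: "g V \<noteq> V" using fixed_line_pointwise xV V p1 by blast
  have VL: "V \<in> Lines G" using V Inc_LinesD by blast
  have "V \<noteq> h2" using xV h2 by auto
  then obtain y where y: "(y, V) \<in> Inc G" "(y, h2) \<in> Inc G"
    using meet_exists VL h2 Inc_LinesD by metis
  \<comment> \<open>Excluding \<open>y\<close>, the meet of \<open>V\<close> and \<open>h2\<close>,
    keeps the line from \<open>x\<close> to \<open>p3\<close> different from
    \<open>h2\<close>.\<close>
  have "infinite ({p \<in> row G V. f p \<noteq> p} - {p1, y})"
    using moved_points_infinite[OF VL gV] by simp
  from infinite_imp_nonempty[OF this]
  obtain p3 where p3: "(p3, V) \<in> Inc G" "f p3 \<noteq> p3" "p3 \<noteq> p1" "p3 \<noteq> y"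
    by (auto simp: row_def)
  have xp3: "x \<noteq> p3" using p3 centre by auto
  obtain h3 where h3: "(x, h3) \<in> Inc G" "(p3, h3) \<in> Inc G"
    using join_exists[of x p3] xp3 centre p3 Inc_PointsD by blast
  have h13: "h1 \<noteq> h3" using h1 h3 V p3 join_unique by metis
  have h23: "h2 \<noteq> h3" using h2 h3 V p3 y \<open>V \<noteq> h2\<close> join_unique by metis
  have "p2 \<noteq> p3" using h2 h3 h23 xp join_unique by metis
  then obtain W where W: "(p2, W) \<in> Inc G" "(p3, W) \<in> Inc G"
    using join_exists[of p2 p3] p2 p3 Inc_PointsD by blast
  have "\<exists>P L. confined G P L \<and> P \<noteq> {}"
    by (rule desargues_confined[of h1 h2 h3 p1 p2 p3 U V W])
      (use h1 h2 h3 p1 p2 p3 V W h12 h13 h23 in auto)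
  then show False using unconfined by blast
qed

section \<open>The stages of the free completion\<close>

definition partial_plane :: "('p, 'l) geometry \<Rightarrow> bool" where
  "partial_plane G \<longleftrightarrow> Inc G \<subseteq> Points G \<times> Lines G \<and>
     (\<forall>p q l m. (p, l) \<in> Inc G \<and> (q, l) \<in> Inc G \<and> (p, m) \<in> Inc G \<and> (q, m) \<in> Inc G \<longrightarrow>
        p = q \<or> l = m)"

text \<open>The condition on labels guarantees that the label of a new element is not yet in use.\<close>

definition labelled_plane :: "(('p, 'l) free_point, ('p, 'l) free_line) geometry \<Rightarrow> bool" where
  "labelled_plane G \<longleftrightarrow> partial_plane G \<and>
     (\<forall>l m. Meet (Upair l m) \<in> Points G \<longrightarrow> (Meet (Upair l m), l) \<in> Inc G) \<and>
     (\<forall>p q. Join (Upair p q) \<in> Lines G \<longrightarrow> (p, Join (Upair p q)) \<in> Inc G)"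

section \<open>Incidence before and after one construction step\<close>

definition unmet :: "('p, 'l) geometry \<Rightarrow> 'l \<Rightarrow> 'l \<Rightarrow> bool" where
  "unmet G l m \<longleftrightarrow> l \<in> Lines G \<and> m \<in> Lines G \<and> l \<noteq> m \<and>
     \<not> (\<exists>p \<in> Points G. (p, l) \<in> Inc G \<and> (p, m) \<in> Inc G)"

definition unjoined :: "('p, 'l) geometry \<Rightarrow> 'p \<Rightarrow> 'p \<Rightarrow> bool" where
  "unjoined G p q \<longleftrightarrow> p \<in> Points G \<and> q \<in> Points G \<and> p \<noteq> q \<and>
     \<not> (\<exists>l \<in> Lines G. (p, l) \<in> Inc G \<and> (q, l) \<in> Inc G)"

lemma unmet_sym: "unmet G l m \<longleftrightarrow> unmet G m l"
  by (auto simp: unmet_def)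

lemma unjoined_sym: "unjoined G p q \<longleftrightarrow> unjoined G q p"
  by (auto simp: unjoined_def)

text \<open>Symmetry of \<open>unmet\<close> and of \<open>Upair\<close> allows the incident line
  \<open>k\<close> to be listed first, which merges the two alternatives of the definition.\<close>

lemma Points_add_points: "Points (add_points G) = Points G \<union> {Meet (Upair l m) |l m. unmet G l m}"
  and Lines_add_points [simp]: "Lines (add_points G) = Lines G"
  and Inc_add_points: "(p, k) \<in> Inc (add_points G) \<longleftrightarrow>
        (p, k) \<in> Inc G \<or> (\<exists>m. unmet G k m \<and> p = Meet (Upair k m))"
proof -
  show "Points (add_points G) = Points G \<union> {Meet (Upair l m) |l m. unmet G l m}"
    "Lines (add_points G) = Lines G"
    by (simp_all add: add_points_def unmet_def Let_def)
  have "(p, k) \<in> Inc (add_points G) \<longleftrightarrow>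
      (p, k) \<in> Inc G \<or> (\<exists>l m. unmet G l m \<and> p = Meet (Upair l m) \<and> (k = l \<or> k = m))"
    by (auto simp: add_points_def unmet_def Let_def)
  also have "\<dots> \<longleftrightarrow> (p, k) \<in> Inc G \<or> (\<exists>m. unmet G k m \<and> p = Meet (Upair k m))"
    using unmet_sym[of G] Upair_inject by metis
  finally show "(p, k) \<in> Inc (add_points G) \<longleftrightarrow>
        (p, k) \<in> Inc G \<or> (\<exists>m. unmet G k m \<and> p = Meet (Upair k m))" .
qed

lemma Lines_add_lines: "Lines (add_lines G) = Lines G \<union> {Join (Upair p q) |p q. unjoined G p q}"
  and Points_add_lines [simp]: "Points (add_lines G) = Points G"
  and Inc_add_lines: "(r, k) \<in> Inc (add_lines G) \<longleftrightarrow>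
        (r, k) \<in> Inc G \<or> (\<exists>q. unjoined G r q \<and> k = Join (Upair r q))"
proof -
  show "Lines (add_lines G) = Lines G \<union> {Join (Upair p q) |p q. unjoined G p q}"
    "Points (add_lines G) = Points G"
    by (simp_all add: add_lines_def unjoined_def Let_def)
  have "(r, k) \<in> Inc (add_lines G) \<longleftrightarrow>
      (r, k) \<in> Inc G \<or> (\<exists>p q. unjoined G p q \<and> k = Join (Upair p q) \<and> (r = p \<or> r = q))"
    by (auto simp: add_lines_def unjoined_def Let_def)
  also have "\<dots> \<longleftrightarrow> (r, k) \<in> Inc G \<or> (\<exists>q. unjoined G r q \<and> k = Join (Upair r q))"
    using unjoined_sym[of G] Upair_inject by metis
  finally show "(r, k) \<in> Inc (add_lines G) \<longleftrightarrow>
        (r, k) \<in> Inc G \<or> (\<exists>q. unjoined G r q \<and> k = Join (Upair r q))" .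
qed

lemma labelled_planeD:
  assumes "labelled_plane G"
  shows "(p, l) \<in> Inc G \<Longrightarrow> p \<in> Points G" "(p, l) \<in> Inc G \<Longrightarrow> l \<in> Lines G"
    and "(p, l) \<in> Inc G \<Longrightarrow> (q, l) \<in> Inc G \<Longrightarrow> (p, m) \<in> Inc G \<Longrightarrow> (q, m) \<in> Inc G \<Longrightarrow> p \<noteq> q \<Longrightarrow> l = m"
    and "Meet (Upair l m) \<in> Points G \<Longrightarrow> (Meet (Upair l m), l) \<in> Inc G"
    and "Join (Upair p q) \<in> Lines G \<Longrightarrow> (p, Join (Upair p q)) \<in> Inc G"
  using assms unfolding labelled_plane_def partial_plane_def by blast+

lemma Upair_commute: "Upair a b = Upair b a"
  by simp

text \<open>A label already in use is incident with both of its lines, which would then have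
  met.\<close>

lemma Meet_fresh:
  assumes "labelled_plane G" "unmet G l m"
  shows "Meet (Upair l m) \<notin> Points G"
proof
  assume mem: "Meet (Upair l m) \<in> Points G"
  then have "(Meet (Upair l m), l) \<in> Inc G" using labelled_planeD(4) assms(1) by blast
  moreover have "(Meet (Upair l m), m) \<in> Inc G"
    using labelled_planeD(4)[OF assms(1), of m l] mem Upair_commute by metis
  ultimately show False using assms(2) mem by (auto simp: unmet_def)
qed

lemma Join_fresh:
  assumes "labelled_plane G" "unjoined G p q"
  shows "Join (Upair p q) \<notin> Lines G"
proof
  assume mem: "Join (Upair p q) \<in> Lines G"
  then have "(p, Join (Upair p q)) \<in> Inc G" using labelled_planeD(5) assms(1) by blast
  moreover have "(q, Join (Upair p q)) \<in> Inc G"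
    using labelled_planeD(5)[OF assms(1), of q p] mem Upair_commute by metis
  ultimately show False using assms(2) mem by (auto simp: unjoined_def)
qed

text \<open>Every added incidence involves a fresh label, so nothing changes at old points.\<close>

lemma Inc_add_points_old:
  assumes "labelled_plane G" "p \<in> Points G"
  shows "(p, l) \<in> Inc (add_points G) \<longleftrightarrow> (p, l) \<in> Inc G"
  using assms Meet_fresh by (auto simp: Inc_add_points)

lemma Inc_add_lines_old:
  assumes "labelled_plane G" "l \<in> Lines G"
  shows "(p, l) \<in> Inc (add_lines G) \<longleftrightarrow> (p, l) \<in> Inc G"
  using assms Join_fresh by (auto simp: Inc_add_lines)

text \<open>This is the freeness of the construction: a new point lies on exactly two lines, one
  fewer than a confined configuration demands.\<close>

lemma Inc_add_points_new:
  assumes "labelled_plane G" "unmet G l m"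
  shows "(Meet (Upair l m), k) \<in> Inc (add_points G) \<longleftrightarrow> k = l \<or> k = m"
  using assms Meet_fresh[OF assms] labelled_planeD(1)[OF assms(1)] unmet_sym[of G l m]
  by (auto simp: Inc_add_points)

lemma Inc_add_lines_new:
  assumes "labelled_plane G" "unjoined G p q"
  shows "(r, Join (Upair p q)) \<in> Inc (add_lines G) \<longleftrightarrow> r = p \<or> r = q"
  using assms Join_fresh[OF assms] labelled_planeD(2)[OF assms(1)] unjoined_sym[of G p q]
  by (auto simp: Inc_add_lines)

lemma labelled_plane_add_points:
  assumes G: "labelled_plane G"
  shows "labelled_plane (add_points G)"
proof -
  have "Inc (add_points G) \<subseteq> Points (add_points G) \<times> Lines (add_points G)"
  proof safe
    fix p l assume "(p, l) \<in> Inc (add_points G)"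
    then show "p \<in> Points (add_points G)" "l \<in> Lines (add_points G)"
      using labelled_planeD(1,2)[OF G] unfolding Inc_add_points Points_add_points Lines_add_points
      by (blast, auto simp: unmet_def)
  qed
  moreover have "p = q \<or> l = m"
    if I: "(p, l) \<in> Inc (add_points G)" "(q, l) \<in> Inc (add_points G)"
      "(p, m) \<in> Inc (add_points G)" "(q, m) \<in> Inc (add_points G)" for p q l m
  proof (rule ccontr)
    assume neq: "\<not> (p = q \<or> l = m)"
    \<comment> \<open>A new point on both lines must be the label of the pair, available only if the
      lines shared no old point. Hence two distinct common points would both be old, where
      uniqueness already holds.\<close>
    have new: "r = Meet (Upair l m) \<and> unmet G l m"
      if "r \<notin> Points G" "(r, l) \<in> Inc (add_points G)" "(r, m) \<in> Inc (add_points G)" for r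
      using that neq labelled_planeD(1)[OF G] by (auto simp: Inc_add_points)
    have old: "\<not> unmet G l m"
      if "r \<in> Points G" "(r, l) \<in> Inc (add_points G)" "(r, m) \<in> Inc (add_points G)" for r
      using that Inc_add_points_old[OF G] by (auto simp: unmet_def)
    show False
    proof (cases "p \<in> Points G \<and> q \<in> Points G")
      case True
      then show False using I neq labelled_planeD(3)[OF G] Inc_add_points_old[OF G] by metis
    next
      case False
      then show False using new old I neq by metis
    qed
  qed
  ultimately have "partial_plane (add_points G)" unfolding partial_plane_def by blast
  moreover have "(Meet (Upair l m), l) \<in> Inc (add_points G)"
    if "Meet (Upair l m) \<in> Points (add_points G)" for l m
    using that labelled_planeD(4)[OF G] unmet_sym[of G]
    by (auto simp: Points_add_points Inc_add_points)
  moreover have "(p, Join (Upair p q)) \<in> Inc (add_points G)"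
    if "Join (Upair p q) \<in> Lines (add_points G)" for p q
    using that labelled_planeD(5)[OF G] by (auto simp: Inc_add_points)
  ultimately show ?thesis unfolding labelled_plane_def by blast
qed

lemma labelled_plane_add_lines:
  assumes G: "labelled_plane G"
  shows "labelled_plane (add_lines G)"
proof -
  have "Inc (add_lines G) \<subseteq> Points (add_lines G) \<times> Lines (add_lines G)"
  proof safe
    fix p l assume "(p, l) \<in> Inc (add_lines G)"
    then show "l \<in> Lines (add_lines G)" "p \<in> Points (add_lines G)"
      using labelled_planeD(1,2)[OF G] unfolding Inc_add_lines Lines_add_lines Points_add_lines
      by (blast, auto simp: unjoined_def)
  qed
  moreover have "p = q \<or> l = m"
    if I: "(p, l) \<in> Inc (add_lines G)" "(q, l) \<in> Inc (add_lines G)"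
      "(p, m) \<in> Inc (add_lines G)" "(q, m) \<in> Inc (add_lines G)" for p q l m
  proof (rule ccontr)
    assume neq: "\<not> (p = q \<or> l = m)"
    have new: "k = Join (Upair p q) \<and> unjoined G p q"
      if "k \<notin> Lines G" "(p, k) \<in> Inc (add_lines G)" "(q, k) \<in> Inc (add_lines G)" for k
      using that neq labelled_planeD(2)[OF G] by (auto simp: Inc_add_lines)
    have old: "\<not> unjoined G p q"
      if "k \<in> Lines G" "(p, k) \<in> Inc (add_lines G)" "(q, k) \<in> Inc (add_lines G)" for k
      using that Inc_add_lines_old[OF G] by (auto simp: unjoined_def)
    show False
    proof (cases "l \<in> Lines G \<and> m \<in> Lines G")
      case True
      then show False using I neq labelled_planeD(3)[OF G] Inc_add_lines_old[OF G] by metis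
    next
      case False
      then show False using new old I neq by metis
    qed
  qed
  ultimately have "partial_plane (add_lines G)" unfolding partial_plane_def by blast
  moreover have "(p, Join (Upair p q)) \<in> Inc (add_lines G)"
    if "Join (Upair p q) \<in> Lines (add_lines G)" for p q
    using that labelled_planeD(5)[OF G] unjoined_sym[of G]
    by (auto simp: Lines_add_lines Inc_add_lines)
  moreover have "(Meet (Upair l m), l) \<in> Inc (add_lines G)"
    if "Meet (Upair l m) \<in> Points (add_lines G)" for l m
    using that labelled_planeD(4)[OF G] by (auto simp: Inc_add_lines)
  ultimately show ?thesis unfolding labelled_plane_def by blast
qed

lemma labelled_plane_embed:
  assumes "partial_plane G"
  shows "labelled_plane (embed G)"
  using assms unfolding labelled_plane_def partial_plane_def embed_def by auto blast+

lemma labelled_plane_free_stage: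
  assumes "partial_plane G"
  shows "labelled_plane (free_stage G i)"
  by (induction i)
    (simp_all add: assms labelled_plane_embed labelled_plane_add_points labelled_plane_add_lines)

lemma free_stage_mono:
  assumes "i \<le> j"
  shows "Points (free_stage G i) \<subseteq> Points (free_stage G j)"
    and "Lines (free_stage G i) \<subseteq> Lines (free_stage G j)"
    and "Inc (free_stage G i) \<subseteq> Inc (free_stage G j)"
proof -
  have "Points (free_stage G i) \<subseteq> Points (free_stage G (Suc i)) \<and>
      Lines (free_stage G i) \<subseteq> Lines (free_stage G (Suc i)) \<and>
      Inc (free_stage G i) \<subseteq> Inc (free_stage G (Suc i))" for i
    by (auto simp: Points_add_points Inc_add_points Lines_add_lines Inc_add_lines)
  then show "Points (free_stage G i) \<subseteq> Points (free_stage G j)"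
    "Lines (free_stage G i) \<subseteq> Lines (free_stage G j)"
    "Inc (free_stage G i) \<subseteq> Inc (free_stage G j)"
    using assms lift_Suc_mono_le[where f = "\<lambda>i. Points (free_stage G i)"]
      lift_Suc_mono_le[where f = "\<lambda>i. Lines (free_stage G i)"]
      lift_Suc_mono_le[where f = "\<lambda>i. Inc (free_stage G i)"] by auto
qed

lemma Points_free_completion: "Points (free_completion G) = (\<Union>i. Points (free_stage G i))"
  and Lines_free_completion: "Lines (free_completion G) = (\<Union>i. Lines (free_stage G i))"
  and Inc_free_completion: "Inc (free_completion G) = (\<Union>i. Inc (free_stage G i))"
  by (simp_all add: free_completion_def)

section \<open>Finite parts of the completion appear at a stage\<close>

lemma finite_subset_incseq_Union:
  fixes A :: "nat \<Rightarrow> 'a set"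
  assumes "finite S" "S \<subseteq> (\<Union>i. A i)" "\<And>i j. i \<le> j \<Longrightarrow> A i \<subseteq> A j"
  shows "\<exists>i. \<forall>j \<ge> i. S \<subseteq> A j"
  using assms(1,2)
proof (induction S rule: finite_induct)
  case (insert a S)
  then obtain i where i: "\<forall>j \<ge> i. S \<subseteq> A j" by auto
  obtain k where "a \<in> A k" using insert.prems by auto
  then have "insert a S \<subseteq> A j" if "max i k \<le> j" for j
    using that i assms(3)[of k j] by auto
  then show ?case by blast
qed simp

text \<open>The claim covers all later stages, so that a stage of the parity required by the next
  construction step can be chosen.\<close>

lemma finite_subset_free_stage:
  assumes "finite P" "finite L" "P \<subseteq> Points (free_completion G)" "L \<subseteq> Lines (free_completion G)"
  obtains i where "\<And>j. i \<le> j \<Longrightarrow> P \<subseteq> Points (free_stage G j) \<and> L \<subseteq> Lines (free_stage G j) \<and>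
    Inc (free_completion G) \<inter> (P \<times> L) = Inc (free_stage G j) \<inter> (P \<times> L)"
proof -
  have "\<exists>i. \<forall>j \<ge> i. P \<subseteq> Points (free_stage G j)"
    using assms by (intro finite_subset_incseq_Union)
      (auto simp: Points_free_completion dest: free_stage_mono)
  then obtain i1 where 1: "\<forall>j \<ge> i1. P \<subseteq> Points (free_stage G j)" by blast
  have "\<exists>i. \<forall>j \<ge> i. L \<subseteq> Lines (free_stage G j)"
    using assms by (intro finite_subset_incseq_Union)
      (auto simp: Lines_free_completion dest: free_stage_mono)
  then obtain i2 where 2: "\<forall>j \<ge> i2. L \<subseteq> Lines (free_stage G j)" by blast
  have "\<exists>i. \<forall>j \<ge> i. Inc (free_completion G) \<inter> (P \<times> L) \<subseteq> Inc (free_stage G j)"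
    using assms by (intro finite_subset_incseq_Union)
      (auto simp: Inc_free_completion dest: free_stage_mono)
  then obtain i3 where 3: "\<forall>j \<ge> i3. Inc (free_completion G) \<inter> (P \<times> L) \<subseteq> Inc (free_stage G j)"
    by blast
  have "Inc (free_stage G j) \<subseteq> Inc (free_completion G)" for j
    by (auto simp: Inc_free_completion)
  then have "P \<subseteq> Points (free_stage G j) \<and> L \<subseteq> Lines (free_stage G j) \<and>
      Inc (free_completion G) \<inter> (P \<times> L) = Inc (free_stage G j) \<inter> (P \<times> L)"
    if "max i1 (max i2 i3) \<le> j" for j
    using 1 2 3 that by (simp, blast)
  then show thesis by (rule that)
qed

section \<open>Confined configurations descend to the initial geometry\<close>

lemma card_le_2I: "A \<subseteq> {a, b} \<Longrightarrow> card A \<le> 2"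
  using card_mono[of "{a, b}" A] by (auto simp: card_insert_if split: if_splits)

text \<open>A new point has too few lines to belong to \<open>P\<close>, and incidences at old
  points are unchanged.\<close>

lemma confined_add_points:
  assumes G: "labelled_plane G" and c: "confined (add_points G) P L"
  shows "confined G P L"
proof -
  have "p \<in> Points G" if p: "p \<in> P" for p
  proof (rule ccontr)
    assume "p \<notin> Points G"
    then obtain l m where "unmet G l m" "p = Meet (Upair l m)"
      using c p by (auto simp: confined_def Points_add_points)
    then have "{k \<in> L. (p, k) \<in> Inc (add_points G)} \<subseteq> {l, m}"
      using Inc_add_points_new[OF G] by auto
    then have "card {k \<in> L. (p, k) \<in> Inc (add_points G)} \<le> 2" by (rule card_le_2I)
    moreover have "3 \<le> card {k \<in> L. (p, k) \<in> Inc (add_points G)}"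
      using c p by (simp add: confined_def)
    ultimately show False by simp
  qed
  then have P: "P \<subseteq> Points G" by blast
  then have "{l \<in> L. (p, l) \<in> Inc (add_points G)} = {l \<in> L. (p, l) \<in> Inc G}" if "p \<in> P" for p
    using that Inc_add_points_old[OF G] by blast
  moreover have "{p \<in> P. (p, l) \<in> Inc (add_points G)} = {p \<in> P. (p, l) \<in> Inc G}" for l
    using P Inc_add_points_old[OF G] by blast
  ultimately show ?thesis using c P by (simp add: confined_def)
qed

lemma confined_add_lines:
  assumes G: "labelled_plane G" and c: "confined (add_lines G) P L"
  shows "confined G P L"
proof -
  have "l \<in> Lines G" if l: "l \<in> L" for l
  proof (rule ccontr)
    assume "l \<notin> Lines G"
    then obtain p q where "unjoined G p q" "l = Join (Upair p q)"
      using c l by (auto simp: confined_def Lines_add_lines)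
    then have "{r \<in> P. (r, l) \<in> Inc (add_lines G)} \<subseteq> {p, q}"
      using Inc_add_lines_new[OF G] by auto
    then have "card {r \<in> P. (r, l) \<in> Inc (add_lines G)} \<le> 2" by (rule card_le_2I)
    moreover have "3 \<le> card {r \<in> P. (r, l) \<in> Inc (add_lines G)}"
      using c l by (simp add: confined_def)
    ultimately show False by simp
  qed
  then have L: "L \<subseteq> Lines G" by blast
  then have "{p \<in> P. (p, l) \<in> Inc (add_lines G)} = {p \<in> P. (p, l) \<in> Inc G}" if "l \<in> L" for l
    using that Inc_add_lines_old[OF G] by blast
  moreover have "{l \<in> L. (p, l) \<in> Inc (add_lines G)} = {l \<in> L. (p, l) \<in> Inc G}" for p
    using L Inc_add_lines_old[OF G] by blast
  ultimately show ?thesis using c L by (simp add: confined_def)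
qed

text \<open>Lines with at most two points cannot belong to \<open>L\<close>, and without lines no
  point reaches three incidences.\<close>

lemma confined_embed:
  assumes rows: "\<And>l. l \<in> Lines G \<Longrightarrow> finite (row G l) \<and> card (row G l) \<le> 2"
    and sub: "Inc G \<subseteq> Points G \<times> Lines G"
    and c: "confined (embed G) P L"
  shows "P = {}"
proof -
  have "L = {}"
  proof (rule ccontr)
    assume "L \<noteq> {}"
    then obtain l where l: "Line l \<in> L" "l \<in> Lines G"
      using c unfolding confined_def embed_def by fastforce
    have "{p \<in> P. (p, Line l) \<in> Inc (embed G)} \<subseteq> Point ` row G l" (is "_ \<subseteq> ?R")
      using sub by (auto simp: embed_def row_def)
    then have "card {p \<in> P. (p, Line l) \<in> Inc (embed G)} \<le> card ?R"
      by (rule card_mono[rotated]) (use rows[OF l(2)] in simp)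
    also have "\<dots> \<le> card (row G l)" using rows[OF l(2)] card_image_le by blast
    also have "\<dots> \<le> 2" using rows[OF l(2)] by blast
    moreover have "3 \<le> card {p \<in> P. (p, Line l) \<in> Inc (embed G)}"
      using c l by (simp add: confined_def)
    ultimately show False by linarith
  qed
  then show ?thesis using c by (auto simp: confined_def)
qed

lemma confined_free_completion:
  assumes G: "partial_plane G"
    and rows: "\<And>l. l \<in> Lines G \<Longrightarrow> finite (row G l) \<and> card (row G l) \<le> 2"
    and c: "confined (free_completion G) P L"
  shows "P = {}"
proof -
  have stage: "confined (free_stage G i) P L \<Longrightarrow> P = {}" for i
  proof (induction i)
    case 0
    show ?case
      by (rule confined_embed[of G P L]) (use rows G 0 in \<open>auto simp: partial_plane_def\<close>)
  next
    case (Suc i)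
    have "confined (free_stage G i) P L"
    proof (cases "even i")
      case True
      then show ?thesis
        using Suc.prems confined_add_points[OF labelled_plane_free_stage[OF G]] by simp
    next
      case False
      then show ?thesis
        using Suc.prems confined_add_lines[OF labelled_plane_free_stage[OF G]] by simp
    qed
    then show ?case by (rule Suc.IH)
  qed
  obtain i where "\<And>j. i \<le> j \<Longrightarrow> P \<subseteq> Points (free_stage G j) \<and> L \<subseteq> Lines (free_stage G j) \<and>
      Inc (free_completion G) \<inter> (P \<times> L) = Inc (free_stage G j) \<inter> (P \<times> L)"
    by (rule finite_subset_free_stage[of P L G]) (use c in \<open>auto simp: confined_def\<close>)
  from this[OF order_refl] have sub: "P \<subseteq> Points (free_stage G i)" "L \<subseteq> Lines (free_stage G i)"
    and I: "\<And>p l. p \<in> P \<Longrightarrow> l \<in> L \<Longrightarrow>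
      (p, l) \<in> Inc (free_completion G) \<longleftrightarrow> (p, l) \<in> Inc (free_stage G i)" by blast+
  have "{l \<in> L. (p, l) \<in> Inc (free_completion G)} = {l \<in> L. (p, l) \<in> Inc (free_stage G i)}"
    if "p \<in> P" for p using that I by blast
  moreover have "{p \<in> P. (p, l) \<in> Inc (free_completion G)} = {p \<in> P. (p, l) \<in> Inc (free_stage G i)}"
    if "l \<in> L" for l using that I by blast
  ultimately have "confined (free_stage G i) P L" using c sub by (simp add: confined_def)
  then show ?thesis by (rule stage)
qed

section \<open>The free completion is a projective plane\<close>

lemma quadrangle_free_stage:
  assumes G: "partial_plane G" and Q: "Q \<subseteq> Points G"
    "\<forall>l \<in> Lines G. card {p \<in> Q. (p, l) \<in> Inc G} \<le> 2"
  shows "\<forall>l \<in> Lines (free_stage G i). card {p \<in> Point ` Q. (p, l) \<in> Inc (free_stage G i)} \<le> 2"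
proof (induction i)
  case 0
  have "{p \<in> Point ` Q. (p, Line l) \<in> Inc (embed G)} = Point ` {p \<in> Q. (p, l) \<in> Inc G}" for l
    by (auto simp: embed_def)
  then show ?case using Q(2) by (auto simp: embed_def card_image inj_on_def)
next
  case (Suc i)
  let ?G = "free_stage G i"
  have lab: "labelled_plane ?G" by (rule labelled_plane_free_stage[OF G])
  have "Point ` Q \<subseteq> Points (free_stage G 0)" using Q(1) by (auto simp: embed_def)
  then have QG: "Point ` Q \<subseteq> Points ?G" using free_stage_mono(1)[of 0 i G] by blast
  have points: "{p \<in> Point ` Q. (p, l) \<in> Inc (add_points ?G)} = {p \<in> Point ` Q. (p, l) \<in> Inc ?G}" for l
    using QG Inc_add_points_old[OF lab] by blast
  have old: "{p \<in> Point ` Q. (p, l) \<in> Inc (add_lines ?G)} = {p \<in> Point ` Q. (p, l) \<in> Inc ?G}"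
    if "l \<in> Lines ?G" for l
    using that Inc_add_lines_old[OF lab] by blast
  \<comment> \<open>A new line carries only the two points \<open>a\<close> and \<open>b\<close> at
    its creation, so the bound holds for any choice of \<open>Q\<close>.\<close>
  have new: "card {p \<in> Point ` Q. (p, Join (Upair a b)) \<in> Inc (add_lines ?G)} \<le> 2"
    if "unjoined ?G a b" for a b
    by (rule card_le_2I[of _ a b]) (use Inc_add_lines_new[OF lab that] in auto)
  show ?case
  proof (cases "even i")
    case True
    then show ?thesis using Suc.IH points by simp
  next
    case False
    then show ?thesis using Suc.IH old new by (auto simp: Lines_add_lines)
  qed
qed

theorem projective_plane_free_completion:
  assumes G: "partial_plane G" and Q: "Q \<subseteq> Points G" "card Q = 4"
    "\<forall>l \<in> Lines G. card {p \<in> Q. (p, l) \<in> Inc G} \<le> 2"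
  shows "projective_plane (free_completion G)"
proof -
  let ?C = "free_completion G"
  note lab = labelled_plane_free_stage[OF G]
  have I: "Inc ?C \<subseteq> Points ?C \<times> Lines ?C"
    using labelled_planeD(1,2)[OF lab]
    by (fastforce simp: Inc_free_completion Points_free_completion Lines_free_completion)
  have unique: "l = m"
    if inc: "(p, l) \<in> Inc ?C" "(q, l) \<in> Inc ?C" "(p, m) \<in> Inc ?C" "(q, m) \<in> Inc ?C" "p \<noteq> q"
    for p q l m
  proof -
    obtain i where i: "\<And>j. i \<le> j \<Longrightarrow> {p, q} \<subseteq> Points (free_stage G j) \<and>
        {l, m} \<subseteq> Lines (free_stage G j) \<and>
        Inc ?C \<inter> ({p, q} \<times> {l, m}) = Inc (free_stage G j) \<inter> ({p, q} \<times> {l, m})"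
      by (rule finite_subset_free_stage[of "{p, q}" "{l, m}" G]) (use inc I in auto)
    have "(p, l) \<in> Inc (free_stage G i)" "(q, l) \<in> Inc (free_stage G i)"
      "(p, m) \<in> Inc (free_stage G i)" "(q, m) \<in> Inc (free_stage G i)"
      using i[of i] inc by blast+
    then show ?thesis using labelled_planeD(3)[OF lab] \<open>p \<noteq> q\<close> by blast
  qed
  have join: "\<exists>l. (p, l) \<in> Inc ?C \<and> (q, l) \<in> Inc ?C"
    if pq: "p \<in> Points ?C" "q \<in> Points ?C" "p \<noteq> q" for p q
  proof -
    obtain i where i: "\<And>j. i \<le> j \<Longrightarrow> {p, q} \<subseteq> Points (free_stage G j) \<and> {} \<subseteq> Lines (free_stage G j) \<and>
        Inc ?C \<inter> ({p, q} \<times> {}) = Inc (free_stage G j) \<inter> ({p, q} \<times> {})"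
      by (rule finite_subset_free_stage[of "{p, q}" "{}" G]) (use pq in auto)
    \<comment> \<open>The stage index is odd because lines are added in passing from an odd stage to
      the next.\<close>
    let ?S = "free_stage G (Suc (2 * i))"
    have S: "{p, q} \<subseteq> Points ?S" using i[of "Suc (2 * i)"] by simp
    have "\<exists>l. (p, l) \<in> Inc (add_lines ?S) \<and> (q, l) \<in> Inc (add_lines ?S)"
    proof (cases "unjoined ?S p q")
      case True
      then show ?thesis using Inc_add_lines_new[OF lab] by blast
    next
      case False
      then show ?thesis using S pq(3) unfolding unjoined_def Inc_add_lines by blast
    qed
    moreover have "add_lines ?S = free_stage G (Suc (Suc (2 * i)))" by simp
    ultimately show ?thesis unfolding Inc_free_completion by (metis UN_I UNIV_I)
  qed
  have meet: "\<exists>p. (p, l) \<in> Inc ?C \<and> (p, m) \<in> Inc ?C"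
    if lm: "l \<in> Lines ?C" "m \<in> Lines ?C" "l \<noteq> m" for l m
  proof -
    obtain i where i: "\<And>j. i \<le> j \<Longrightarrow> {} \<subseteq> Points (free_stage G j) \<and> {l, m} \<subseteq> Lines (free_stage G j) \<and>
        Inc ?C \<inter> ({} \<times> {l, m}) = Inc (free_stage G j) \<inter> ({} \<times> {l, m})"
      by (rule finite_subset_free_stage[of "{}" "{l, m}" G]) (use lm in auto)
    \<comment> \<open>Points are added after an even stage.\<close>
    let ?S = "free_stage G (2 * i)"
    have S: "{l, m} \<subseteq> Lines ?S" using i[of "2 * i"] by simp
    have "\<exists>p. (p, l) \<in> Inc (add_points ?S) \<and> (p, m) \<in> Inc (add_points ?S)"
    proof (cases "unmet ?S l m")
      case True
      then show ?thesis using Inc_add_points_new[OF lab] by blast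
    next
      case False
      then show ?thesis using S lm(3) unfolding unmet_def Inc_add_points by blast
    qed
    moreover have "add_points ?S = free_stage G (Suc (2 * i))" by simp
    ultimately show ?thesis unfolding Inc_free_completion by (metis UN_I UNIV_I)
  qed
  have "\<forall>p \<in> Points ?C. \<forall>q \<in> Points ?C. p \<noteq> q \<longrightarrow>
      (\<exists>!l. l \<in> Lines ?C \<and> (p, l) \<in> Inc ?C \<and> (q, l) \<in> Inc ?C)"
  proof (intro ballI impI)
    fix p q assume pq: "p \<in> Points ?C" "q \<in> Points ?C" "p \<noteq> q"
    then obtain l where "(p, l) \<in> Inc ?C" "(q, l) \<in> Inc ?C" using join by blast
    then show "\<exists>!l. l \<in> Lines ?C \<and> (p, l) \<in> Inc ?C \<and> (q, l) \<in> Inc ?C"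
      using I unique pq(3) by (intro ex1I[of _ l]) auto
  qed
  moreover have "\<forall>l \<in> Lines ?C. \<forall>m \<in> Lines ?C. l \<noteq> m \<longrightarrow>
      (\<exists>!p. p \<in> Points ?C \<and> (p, l) \<in> Inc ?C \<and> (p, m) \<in> Inc ?C)"
  proof (intro ballI impI)
    fix l m assume lm: "l \<in> Lines ?C" "m \<in> Lines ?C" "l \<noteq> m"
    then obtain p where "(p, l) \<in> Inc ?C" "(p, m) \<in> Inc ?C" using meet by blast
    \<comment> \<open>Two common points of distinct lines contradict \<open>unique\<close>, which
      thus serves both uniqueness axioms.\<close>
    then show "\<exists>!p. p \<in> Points ?C \<and> (p, l) \<in> Inc ?C \<and> (p, m) \<in> Inc ?C"
      using I unique lm by blast
  qed
  moreover have "\<exists>Q' \<subseteq> Points ?C. card Q' = 4 \<and>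
      (\<forall>l \<in> Lines ?C. card {p \<in> Q'. (p, l) \<in> Inc ?C} \<le> 2)"
  proof (intro exI[of _ "Point ` Q"] conjI ballI)
    have "Point ` Q \<subseteq> Points (free_stage G 0)" using Q(1) by (auto simp: embed_def)
    then show QC: "Point ` Q \<subseteq> Points ?C" unfolding Points_free_completion by blast
    show "card (Point ` Q) = 4" using Q(2) by (simp add: card_image inj_on_def)
    have finQ: "finite Q" using Q(2) card.infinite by fastforce
    fix l assume l: "l \<in> Lines ?C"
    obtain i where i: "\<And>j. i \<le> j \<Longrightarrow> Point ` Q \<subseteq> Points (free_stage G j) \<and>
        {l} \<subseteq> Lines (free_stage G j) \<and>
        Inc ?C \<inter> (Point ` Q \<times> {l}) = Inc (free_stage G j) \<inter> (Point ` Q \<times> {l})"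
      by (rule finite_subset_free_stage[of "Point ` Q" "{l}" G]) (use l QC finQ in auto)
    then have "{p \<in> Point ` Q. (p, l) \<in> Inc ?C} = {p \<in> Point ` Q. (p, l) \<in> Inc (free_stage G i)}"
      by blast
    then show "card {p \<in> Point ` Q. (p, l) \<in> Inc ?C} \<le> 2"
      using quadrangle_free_stage[OF G Q(1,3), of i] i[of i] by auto
  qed
  ultimately show ?thesis using I unfolding projective_plane_def by argo
qed

section \<open>Extension of automorphisms\<close>

lemma automorphismD:
  assumes "automorphism G f g"
  shows "p \<in> Points G \<Longrightarrow> f p \<in> Points G" "l \<in> Lines G \<Longrightarrow> g l \<in> Lines G"
    and "p \<in> Points G \<Longrightarrow> l \<in> Lines G \<Longrightarrow> (f p, g l) \<in> Inc G \<longleftrightarrow> (p, l) \<in> Inc G"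
    and "p \<in> Points G \<Longrightarrow> q \<in> Points G \<Longrightarrow> f p = f q \<longleftrightarrow> p = q"
    and "l \<in> Lines G \<Longrightarrow> m \<in> Lines G \<Longrightarrow> g l = g m \<longleftrightarrow> l = m"
    and "p \<in> Points G \<Longrightarrow> \<exists>q \<in> Points G. p = f q"
    and "l \<in> Lines G \<Longrightarrow> \<exists>m \<in> Lines G. l = g m"
proof -
  have f: "bij_betw f (Points G) (Points G)" and g: "bij_betw g (Lines G) (Lines G)"
    and I: "\<forall>p \<in> Points G. \<forall>l \<in> Lines G. (f p, g l) \<in> Inc G \<longleftrightarrow> (p, l) \<in> Inc G"
    using assms by (simp_all add: automorphism_def)
  show "p \<in> Points G \<Longrightarrow> f p \<in> Points G" "l \<in> Lines G \<Longrightarrow> g l \<in> Lines G"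
    using f g bij_betwE by blast+
  show "p \<in> Points G \<Longrightarrow> l \<in> Lines G \<Longrightarrow> (f p, g l) \<in> Inc G \<longleftrightarrow> (p, l) \<in> Inc G"
    using I by simp
  show "p \<in> Points G \<Longrightarrow> q \<in> Points G \<Longrightarrow> f p = f q \<longleftrightarrow> p = q"
    "l \<in> Lines G \<Longrightarrow> m \<in> Lines G \<Longrightarrow> g l = g m \<longleftrightarrow> l = m"
    using f g by (auto simp: bij_betw_def inj_on_eq_iff)
  show "p \<in> Points G \<Longrightarrow> \<exists>q \<in> Points G. p = f q" "l \<in> Lines G \<Longrightarrow> \<exists>m \<in> Lines G. l = g m"
    using f g by (auto simp: bij_betw_def)
qed

lemma automorphismI:
  assumes "\<And>p. p \<in> Points G \<Longrightarrow> f p \<in> Points G" "\<And>l. l \<in> Lines G \<Longrightarrow> g l \<in> Lines G"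
    and "\<And>p l. p \<in> Points G \<Longrightarrow> l \<in> Lines G \<Longrightarrow> (f p, g l) \<in> Inc G \<longleftrightarrow> (p, l) \<in> Inc G"
    and "\<And>p q. p \<in> Points G \<Longrightarrow> q \<in> Points G \<Longrightarrow> f p = f q \<Longrightarrow> p = q"
    and "\<And>l m. l \<in> Lines G \<Longrightarrow> m \<in> Lines G \<Longrightarrow> g l = g m \<Longrightarrow> l = m"
    and "\<And>p. p \<in> Points G \<Longrightarrow> \<exists>q \<in> Points G. p = f q"
    and "\<And>l. l \<in> Lines G \<Longrightarrow> \<exists>m \<in> Lines G. l = g m"
  shows "automorphism G f g"
proof -
  have "f ` Points G = Points G" "g ` Lines G = Lines G"
    using assms(1,2,6,7) by (force simp: image_iff)+
  moreover have "inj_on f (Points G)" "inj_on g (Lines G)"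
    using assms(4,5) by (auto intro: inj_onI)
  ultimately show ?thesis using assms(3) by (simp add: automorphism_def bij_betw_def)
qed

lemma automorphism_comp:
  assumes "automorphism G f g" "automorphism G f' g'"
  shows "automorphism G (f \<circ> f') (g \<circ> g')"
proof -
  have "bij_betw (f \<circ> f') (Points G) (Points G)" "bij_betw (g \<circ> g') (Lines G) (Lines G)"
    using assms by (auto simp: automorphism_def intro: bij_betw_trans)
  then show ?thesis
    using automorphismD(1-3)[OF assms(1)] automorphismD(1-3)[OF assms(2)]
    by (simp add: automorphism_def)
qed

text \<open>Surjectivity on points gives the less direct half: a common point of the image lines is
  the image of a common point of \<open>l\<close> and \<open>m\<close>.\<close>

lemma automorphism_unmet_iff:
  assumes A: "automorphism G f g" and "l \<in> Lines G" "m \<in> Lines G"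
  shows "unmet G (g l) (g m) \<longleftrightarrow> unmet G l m"
proof -
  have "(\<exists>p \<in> Points G. (p, g l) \<in> Inc G \<and> (p, g m) \<in> Inc G) \<longleftrightarrow>
      (\<exists>p \<in> Points G. (p, l) \<in> Inc G \<and> (p, m) \<in> Inc G)"
    using automorphismD(1,3,6)[OF A] assms(2,3) by metis
  then show ?thesis using automorphismD(2,5)[OF A] assms(2,3) by (simp add: unmet_def)
qed

lemma automorphism_unjoined_iff:
  assumes A: "automorphism G f g" and "p \<in> Points G" "q \<in> Points G"
  shows "unjoined G (f p) (f q) \<longleftrightarrow> unjoined G p q"
proof -
  have "(\<exists>l \<in> Lines G. (f p, l) \<in> Inc G \<and> (f q, l) \<in> Inc G) \<longleftrightarrow>
      (\<exists>l \<in> Lines G. (p, l) \<in> Inc G \<and> (q, l) \<in> Inc G)"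
    using automorphismD(2,3,7)[OF A] assms(2,3) by metis
  then show ?thesis using automorphismD(1,4)[OF A] assms(2,3) by (simp add: unjoined_def)
qed

lemma Meet_mem: "unmet G l m \<Longrightarrow> Meet (Upair l m) \<in> Points (add_points G)"
  unfolding Points_add_points by blast

lemma Join_mem: "unjoined G p q \<Longrightarrow> Join (Upair p q) \<in> Lines (add_lines G)"
  unfolding Lines_add_lines by blast

lemma unmetD: "unmet G l m \<Longrightarrow> l \<in> Lines G" "unmet G l m \<Longrightarrow> m \<in> Lines G"
  by (simp_all add: unmet_def)

lemma unjoinedD: "unjoined G p q \<Longrightarrow> p \<in> Points G" "unjoined G p q \<Longrightarrow> q \<in> Points G"
  by (simp_all add: unjoined_def)

text \<open>The assumption on labels is the recursion equation of \<open>extend_point\<close>. With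
  \<open>f\<close> and \<open>g\<close> abstract, one and the same pair of maps becomes an
  automorphism of every stage.\<close>

lemma automorphism_add_points:
  assumes G: "labelled_plane G" and A: "automorphism G f g"
    and f: "\<And>l m. f (Meet (Upair l m)) = Meet (Upair (g l) (g m))"
  shows "automorphism (add_points G) f g"
proof -
  have new: "unmet G (g l) (g m)" if "unmet G l m" for l m
    using that automorphism_unmet_iff[OF A unmetD(1)[OF that] unmetD(2)[OF that]] by simp
  have point_cases: thesis
    if "p \<in> Points (add_points G)" "p \<in> Points G \<Longrightarrow> thesis"
      "\<And>l m. unmet G l m \<Longrightarrow> p = Meet (Upair l m) \<Longrightarrow> thesis" for p thesis
    using that by (auto simp: Points_add_points)
  show ?thesis
  proof (rule automorphismI)
    fix p assume "p \<in> Points (add_points G)"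
    then show "f p \<in> Points (add_points G)"
      by (rule point_cases) (use automorphismD(1)[OF A] Meet_mem[OF new] f in \<open>simp_all add: Points_add_points\<close>)
  next
    fix l assume "l \<in> Lines (add_points G)"
    then show "g l \<in> Lines (add_points G)" "\<exists>m \<in> Lines (add_points G). l = g m"
      using automorphismD(2,7)[OF A] by auto
  next
    fix l m assume "l \<in> Lines (add_points G)" "m \<in> Lines (add_points G)" "g l = g m"
    then show "l = m" using automorphismD(5)[OF A] by auto
  next
    fix p k assume p: "p \<in> Points (add_points G)" and "k \<in> Lines (add_points G)"
    then have k: "k \<in> Lines G" by simp
    from p show "(f p, g k) \<in> Inc (add_points G) \<longleftrightarrow> (p, k) \<in> Inc (add_points G)"
    proof (rule point_cases)
      assume "p \<in> Points G"
      then show ?thesis using k Inc_add_points_old[OF G] automorphismD(1,3)[OF A] by simp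
    next
      fix l m assume u: "unmet G l m" and "p = Meet (Upair l m)"
      then show ?thesis
        using Inc_add_points_new[OF G u] Inc_add_points_new[OF G new[OF u]]
          automorphismD(5)[OF A] k unmetD[OF u] f by simp
    qed
  next
    fix p q assume p: "p \<in> Points (add_points G)" and q: "q \<in> Points (add_points G)"
      and eq: "f p = f q"
    \<comment> \<open>Images of new points are new, so an old and a new point never share an
      image.\<close>
    have fresh: "f (Meet (Upair l m)) \<notin> Points G" if "unmet G l m" for l m
      using Meet_fresh[OF G new[OF that]] f by simp
    from p show "p = q"
    proof (rule point_cases)
      assume pG: "p \<in> Points G"
      from q show ?thesis
        by (rule point_cases) (use pG eq automorphismD(1,4)[OF A] fresh in metis)+
    next
      fix l m assume u: "unmet G l m" and pm: "p = Meet (Upair l m)"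
      from q show ?thesis
      proof (rule point_cases)
        assume "q \<in> Points G"
        then show ?thesis using pm eq automorphismD(1)[OF A] fresh[OF u] by metis
      next
        fix l' m' assume u': "unmet G l' m'" and "q = Meet (Upair l' m')"
        then show ?thesis
          using pm eq f automorphismD(5)[OF A] unmetD[OF u] unmetD[OF u'] by simp
      qed
    qed
  next
    fix p assume "p \<in> Points (add_points G)"
    then show "\<exists>q \<in> Points (add_points G). p = f q"
    proof (rule point_cases)
      assume "p \<in> Points G"
      then show ?thesis using automorphismD(6)[OF A] by (auto simp: Points_add_points)
    next
      fix l m assume u: "unmet G l m" and p: "p = Meet (Upair l m)"
      obtain l' m' where lm: "l' \<in> Lines G" "m' \<in> Lines G" "l = g l'" "m = g m'"
        using automorphismD(7)[OF A] unmetD[OF u] by metis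
      then have "unmet G l' m'" using u automorphism_unmet_iff[OF A] by simp
      then have "Meet (Upair l' m') \<in> Points (add_points G)" by (rule Meet_mem)
      then show ?thesis using p lm f by metis
    qed
  qed
qed

lemma automorphism_add_lines:
  assumes G: "labelled_plane G" and A: "automorphism G f g"
    and g: "\<And>p q. g (Join (Upair p q)) = Join (Upair (f p) (f q))"
  shows "automorphism (add_lines G) f g"
proof -
  have new: "unjoined G (f p) (f q)" if "unjoined G p q" for p q
    using that automorphism_unjoined_iff[OF A unjoinedD(1)[OF that] unjoinedD(2)[OF that]] by simp
  have line_cases: thesis
    if "l \<in> Lines (add_lines G)" "l \<in> Lines G \<Longrightarrow> thesis"
      "\<And>p q. unjoined G p q \<Longrightarrow> l = Join (Upair p q) \<Longrightarrow> thesis" for l thesis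
    using that by (auto simp: Lines_add_lines)
  show ?thesis
  proof (rule automorphismI)
    fix l assume "l \<in> Lines (add_lines G)"
    then show "g l \<in> Lines (add_lines G)"
      by (rule line_cases) (use automorphismD(2)[OF A] Join_mem[OF new] g in \<open>simp_all add: Lines_add_lines\<close>)
  next
    fix p assume "p \<in> Points (add_lines G)"
    then show "f p \<in> Points (add_lines G)" "\<exists>q \<in> Points (add_lines G). p = f q"
      using automorphismD(1,6)[OF A] by auto
  next
    fix p q assume "p \<in> Points (add_lines G)" "q \<in> Points (add_lines G)" "f p = f q"
    then show "p = q" using automorphismD(4)[OF A] by auto
  next
    fix r l assume l: "l \<in> Lines (add_lines G)" and "r \<in> Points (add_lines G)"
    then have r: "r \<in> Points G" by simp
    from l show "(f r, g l) \<in> Inc (add_lines G) \<longleftrightarrow> (r, l) \<in> Inc (add_lines G)"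
    proof (rule line_cases)
      assume "l \<in> Lines G"
      then show ?thesis using r Inc_add_lines_old[OF G] automorphismD(2,3)[OF A] by simp
    next
      fix p q assume u: "unjoined G p q" and "l = Join (Upair p q)"
      then show ?thesis
        using Inc_add_lines_new[OF G u] Inc_add_lines_new[OF G new[OF u]]
          automorphismD(4)[OF A] r unjoinedD[OF u] g by simp
    qed
  next
    fix l m assume l: "l \<in> Lines (add_lines G)" and m: "m \<in> Lines (add_lines G)"
      and eq: "g l = g m"
    have fresh: "g (Join (Upair p q)) \<notin> Lines G" if "unjoined G p q" for p q
      using Join_fresh[OF G new[OF that]] g by simp
    from l show "l = m"
    proof (rule line_cases)
      assume lG: "l \<in> Lines G"
      from m show ?thesis
        by (rule line_cases) (use lG eq automorphismD(2,5)[OF A] fresh in metis)+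
    next
      fix p q assume u: "unjoined G p q" and lp: "l = Join (Upair p q)"
      from m show ?thesis
      proof (rule line_cases)
        assume "m \<in> Lines G"
        then show ?thesis using lp eq automorphismD(2)[OF A] fresh[OF u] by metis
      next
        fix p' q' assume u': "unjoined G p' q'" and "m = Join (Upair p' q')"
        then show ?thesis
          using lp eq g automorphismD(4)[OF A] unjoinedD[OF u] unjoinedD[OF u'] by simp
      qed
    qed
  next
    fix l assume "l \<in> Lines (add_lines G)"
    then show "\<exists>m \<in> Lines (add_lines G). l = g m"
    proof (rule line_cases)
      assume "l \<in> Lines G"
      then show ?thesis using automorphismD(7)[OF A] by (auto simp: Lines_add_lines)
    next
      fix p q assume u: "unjoined G p q" and l: "l = Join (Upair p q)"
      obtain p' q' where pq: "p' \<in> Points G" "q' \<in> Points G" "p = f p'" "q = f q'"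
        using automorphismD(6)[OF A] unjoinedD[OF u] by metis
      then have "unjoined G p' q'" using u automorphism_unjoined_iff[OF A] by simp
      then have "Join (Upair p' q') \<in> Lines (add_lines G)" by (rule Join_mem)
      then show ?thesis using l pq g by metis
    qed
  qed
qed

lemma automorphism_embed:
  assumes A: "automorphism G f g"
  shows "automorphism (embed G) (extend_point f g) (extend_line f g)"
proof (rule automorphismI)
  fix p assume "p \<in> Points (embed G)"
  then show "extend_point f g p \<in> Points (embed G)"
    "\<exists>q \<in> Points (embed G). p = extend_point f g q"
    using automorphismD(1,6)[OF A] by (auto simp: embed_def)
next
  fix l assume "l \<in> Lines (embed G)"
  then show "extend_line f g l \<in> Lines (embed G)"
    "\<exists>m \<in> Lines (embed G). l = extend_line f g m"
    using automorphismD(2,7)[OF A] by (auto simp: embed_def)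
next
  fix p q assume "p \<in> Points (embed G)" "q \<in> Points (embed G)"
    "extend_point f g p = extend_point f g q"
  then show "p = q" using automorphismD(4)[OF A] by (auto simp: embed_def)
next
  fix l m assume "l \<in> Lines (embed G)" "m \<in> Lines (embed G)"
    "extend_line f g l = extend_line f g m"
  then show "l = m" using automorphismD(5)[OF A] by (auto simp: embed_def)
next
  fix p l assume "p \<in> Points (embed G)" "l \<in> Lines (embed G)"
  then obtain p' l' where pl: "p' \<in> Points G" "l' \<in> Lines G" "p = Point p'" "l = Line l'"
    by (auto simp: embed_def)
  have "(Point a, Line b) \<in> Inc (embed G) \<longleftrightarrow> (a, b) \<in> Inc G" for a b
    by (auto simp: embed_def)
  then show "(extend_point f g p, extend_line f g l) \<in> Inc (embed G) \<longleftrightarrow> (p, l) \<in> Inc (embed G)"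
    using pl automorphismD(3)[OF A] by simp
qed

lemma automorphism_free_stage:
  assumes "partial_plane G" "automorphism G f g"
  shows "automorphism (free_stage G i) (extend_point f g) (extend_line f g)"
proof (induction i)
  case 0
  show ?case using automorphism_embed[OF assms(2)] by simp
next
  case (Suc i)
  note lab = labelled_plane_free_stage[OF assms(1), of i]
  show ?case
  proof (cases "even i")
    case True
    then show ?thesis using automorphism_add_points[OF lab Suc.IH] by simp
  next
    case False
    then show ?thesis using automorphism_add_lines[OF lab Suc.IH] by simp
  qed
qed

theorem automorphism_free_completion:
  assumes G: "partial_plane G" and A: "automorphism G f g"
  shows "automorphism (free_completion G) (extend_point f g) (extend_line f g)"
proof -
  note stage = automorphism_free_stage[OF G A]
  have "bij_betw (extend_point f g) (Points (free_completion G)) (Points (free_completion G))"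
    unfolding Points_free_completion
  proof (rule bij_betw_UNION_chain)
    fix i j
    show "Points (free_stage G i) \<subseteq> Points (free_stage G j) \<or> Points (free_stage G j) \<subseteq> Points (free_stage G i)"
      using free_stage_mono(1)[of i j G] free_stage_mono(1)[of j i G] by linarith
    show "bij_betw (extend_point f g) (Points (free_stage G i)) (Points (free_stage G i))"
      using stage by (simp add: automorphism_def)
  qed
  moreover have "bij_betw (extend_line f g) (Lines (free_completion G)) (Lines (free_completion G))"
    unfolding Lines_free_completion
  proof (rule bij_betw_UNION_chain)
    fix i j
    show "Lines (free_stage G i) \<subseteq> Lines (free_stage G j) \<or> Lines (free_stage G j) \<subseteq> Lines (free_stage G i)"
      using free_stage_mono(2)[of i j G] free_stage_mono(2)[of j i G] by linarith
    show "bij_betw (extend_line f g) (Lines (free_stage G i)) (Lines (free_stage G i))"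
      using stage by (simp add: automorphism_def)
  qed
  moreover have "(extend_point f g p, extend_line f g l) \<in> Inc (free_completion G) \<longleftrightarrow>
      (p, l) \<in> Inc (free_completion G)"
    if pl: "p \<in> Points (free_completion G)" "l \<in> Lines (free_completion G)" for p l
  proof -
    let ?p = "extend_point f g p" and ?l = "extend_line f g l"
    have "?p \<in> Points (free_completion G)" "?l \<in> Lines (free_completion G)"
      using pl automorphismD(1,2)[OF stage]
      unfolding Points_free_completion Lines_free_completion by blast+
    note mem = this pl
    \<comment> \<open>The images are included in the finite part, so both sides of the equivalence
      are decided at one stage.\<close>
    obtain i where "\<And>j. i \<le> j \<Longrightarrow> {p, ?p} \<subseteq> Points (free_stage G j) \<and>
        {l, ?l} \<subseteq> Lines (free_stage G j) \<and>
        Inc (free_completion G) \<inter> ({p, ?p} \<times> {l, ?l}) = Inc (free_stage G j) \<inter> ({p, ?p} \<times> {l, ?l})"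
      by (rule finite_subset_free_stage[of "{p, ?p}" "{l, ?l}" G]) (use mem in auto)
    from this[OF order_refl] show ?thesis using automorphismD(3)[OF stage[of i], of p l] by blast
  qed
  ultimately show ?thesis unfolding automorphism_def by blast
qed

section \<open>Functoriality and fixed elements of the extension\<close>

lemma extend_comp:
  "extend_point f g (extend_point f' g' p) = extend_point (f \<circ> f') (g \<circ> g') p"
  "extend_line f g (extend_line f' g' l) = extend_line (f \<circ> f') (g \<circ> g') l"
  by (induction p and l) (auto simp: uprod.map_comp intro!: uprod.map_cong)

text \<open>The maps are controlled only on \<open>G\<close>, not on their whole types, so the
  induction runs over stages rather than over arbitrary labels.\<close>

lemma is_identity_free_completion:
  assumes "is_identity G f g"
  shows "is_identity (free_completion G) (extend_point f g) (extend_line f g)"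
proof -
  have "is_identity (free_stage G i) (extend_point f g) (extend_line f g)" for i
  proof (induction i)
    case 0
    then show ?case using assms by (auto simp: is_identity_def embed_def)
  next
    case (Suc i)
    then show ?case
      by (auto simp: is_identity_def Points_add_points Lines_add_lines unmet_def unjoined_def)
  qed
  then show ?thesis
    by (auto simp: is_identity_def Points_free_completion Lines_free_completion)
qed

text \<open>The single fixed point allowed here is harmless: a fixed new line would need two
  distinct fixed points, and a fixed new point would need fixed lines. Each claim feeds the other,
  so they are proved in one induction.\<close>

lemma extend_line_no_fixed_line:
  assumes order: "is_identity G (f ^^ 3) (g ^^ 3)"
    and points: "\<And>p. p \<in> Points G \<Longrightarrow> f p = p \<Longrightarrow> p = x"
    and lines: "\<And>l. l \<in> Lines G \<Longrightarrow> g l \<noteq> l"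
    and l: "l \<in> Lines (free_completion G)"
  shows "extend_line f g l \<noteq> l"
proof -
  let ?f = "extend_point f g" and ?g = "extend_line f g"
  have cube: "is_identity (free_completion G) (?f \<circ> ?f \<circ> ?f) (?g \<circ> ?g \<circ> ?g)"
  proof -
    have "f ^^ 3 = f \<circ> f \<circ> f" "g ^^ 3 = g \<circ> g \<circ> g" by (auto simp: numeral_3_eq_3)
    then have "is_identity (free_completion G) (extend_point (f \<circ> f \<circ> f) (g \<circ> g \<circ> g))
        (extend_line (f \<circ> f \<circ> f) (g \<circ> g \<circ> g))"
      using is_identity_free_completion[OF order] by simp
    then show ?thesis by (simp add: is_identity_def extend_comp comp_assoc)
  qed
  have cubeP: "?f (?f (?f p)) = p" if "p \<in> Points (free_stage G i)" for p i
    using cube that by (auto simp: is_identity_def Points_free_completion)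
  have cubeL: "?g (?g (?g l)) = l" if "l \<in> Lines (free_stage G i)" for l i
    using cube that by (auto simp: is_identity_def Lines_free_completion)
  have "(\<forall>p \<in> Points (free_stage G i). ?f p = p \<longrightarrow> p = Point x) \<and>
      (\<forall>l \<in> Lines (free_stage G i). ?g l \<noteq> l)" for i
  proof (induction i)
    case 0
    then show ?case using points lines by (auto simp: embed_def)
  next
    case (Suc i)
    let ?G = "free_stage G i"
    \<comment> \<open>An element fixed at a later stage is labelled by an invariant pair; a map whose cube is
      the identity cannot swap that pair, so both its members are fixed at an earlier stage.\<close>
    have False if "unmet ?G l m" "?f (Meet (Upair l m)) = Meet (Upair l m)" for l m
      using that Suc.IH cubeL[of l i] by (auto simp: unmet_def)
    moreover have False if "unjoined ?G p q" "?g (Join (Upair p q)) = Join (Upair p q)" for p q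
      using that Suc.IH cubeP[of p i] by (auto simp: unjoined_def)
    ultimately show ?case
      using Suc.IH by (auto simp: Points_add_points Lines_add_lines
          simp del: extend_point.simps extend_line.simps)
  qed
  then show ?thesis using l by (auto simp: Lines_free_completion)
qed

section \<open>Deleting a line\<close>

lemma delete_line_simps:
  "Points (delete_line G M) = {p \<in> Points G. (p, M) \<notin> Inc G}"
  "Lines (delete_line G M) = Lines G - {M}"
  "Inc (delete_line G M) = Inc G \<inter> ({p \<in> Points G. (p, M) \<notin> Inc G} \<times> (Lines G - {M}))"
  by (simp_all add: delete_line_def Let_def)

lemma automorphism_delete_line:
  assumes A: "automorphism G f g" and M: "M \<in> Lines G" "g M = M"
  shows "automorphism (delete_line G M) f g"
proof -
  have fM: "(f p, M) \<in> Inc G \<longleftrightarrow> (p, M) \<in> Inc G" if "p \<in> Points G" for p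
    using automorphismD(3)[OF A that M(1)] M(2) by simp
  have gM: "g l = M \<longleftrightarrow> l = M" if "l \<in> Lines G" for l
    using automorphismD(5)[OF A that M(1)] M(2) by simp
  show ?thesis
  proof (rule automorphismI)
    fix p assume "p \<in> Points (delete_line G M)"
    then have p: "p \<in> Points G" "(p, M) \<notin> Inc G" by (simp_all add: delete_line_simps)
    then show "f p \<in> Points (delete_line G M)"
      using automorphismD(1)[OF A] fM by (simp add: delete_line_simps)
    obtain q where "q \<in> Points G" "p = f q" using automorphismD(6)[OF A p(1)] by blast
    then show "\<exists>q \<in> Points (delete_line G M). p = f q"
      using p fM by (auto simp: delete_line_simps)
  next
    fix l assume "l \<in> Lines (delete_line G M)"
    then have l: "l \<in> Lines G" "l \<noteq> M" by (simp_all add: delete_line_simps)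
    then show "g l \<in> Lines (delete_line G M)"
      using automorphismD(2)[OF A] gM by (simp add: delete_line_simps)
    obtain m where "m \<in> Lines G" "l = g m" using automorphismD(7)[OF A l(1)] by blast
    then show "\<exists>m \<in> Lines (delete_line G M). l = g m"
      using l gM by (auto simp: delete_line_simps)
  next
    fix p q assume "p \<in> Points (delete_line G M)" "q \<in> Points (delete_line G M)" "f p = f q"
    then show "p = q" using automorphismD(4)[OF A] by (simp add: delete_line_simps)
  next
    fix l m assume "l \<in> Lines (delete_line G M)" "m \<in> Lines (delete_line G M)" "g l = g m"
    then show "l = m" using automorphismD(5)[OF A] by (simp add: delete_line_simps)
  next
    fix p l assume "p \<in> Points (delete_line G M)" "l \<in> Lines (delete_line G M)"
    then show "(f p, g l) \<in> Inc (delete_line G M) \<longleftrightarrow> (p, l) \<in> Inc (delete_line G M)"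
      using automorphismD(1-3)[OF A] fM gM by (simp add: delete_line_simps)
  qed
qed

context plane
begin

lemma partial_plane_delete_line: "partial_plane (delete_line G M)"
  using join_unique unfolding partial_plane_def delete_line_simps by blast

text \<open>The line \<open>l\<close> loses its meet with \<open>M\<close>. For order 2 this leaves
  at most two points, too few for a confined configuration.\<close>

lemma card_row_delete_line:
  assumes "M \<in> Lines G" "l \<in> Lines (delete_line G M)" "card (row G l) = Suc n"
  shows "finite (row (delete_line G M) l)" "card (row (delete_line G M) l) \<le> n"
proof -
  have l: "l \<in> Lines G" "l \<noteq> M" using assms(2) by (simp_all add: delete_line_simps)
  then obtain p where p: "(p, l) \<in> Inc G" "(p, M) \<in> Inc G" using assms(1) meet_exists by blast
  have fin: "finite (row G l)" using assms(3) card.infinite by fastforce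
  have sub: "row (delete_line G M) l \<subseteq> row G l - {p}"
    using p by (auto simp: row_def delete_line_simps)
  then show "finite (row (delete_line G M) l)" using fin finite_subset by blast
  have "card (row (delete_line G M) l) \<le> card (row G l - {p})"
    using sub fin by (intro card_mono) auto
  also have "\<dots> = n" using assms(3) fin p Inc_PointsD by (simp add: row_def)
  finally show "card (row (delete_line G M) l) \<le> n" .
qed

text \<open>A quadrangle of the ambient plane may meet \<open>M\<close>, so the four points are
  built: \<open>x\<close> and one further point on each of the three lines joining \<open>x\<close>
  to \<open>M\<close>. Collinearity needs no discussion, because for order 2 every remaining line
  has at most two points.\<close>

lemma four_points_off_line:
  assumes x: "x \<in> Points G" and M: "M \<in> Lines G" "(x, M) \<notin> Inc G" and card: "card (row G M) = 3"
  obtains Q where "Q \<subseteq> Points (delete_line G M)" "card Q = 4"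
proof -
  have "\<exists>t h. (t, h) \<in> Inc G \<and> (x, h) \<in> Inc G \<and> (m, h) \<in> Inc G \<and> t \<noteq> x \<and> t \<noteq> m" if "m \<in> row G M" for m
  proof -
    have "x \<noteq> m" "m \<in> Points G" using that M(2) by (auto simp: row_def)
    then obtain h where h: "(x, h) \<in> Inc G" "(m, h) \<in> Inc G" using x join_exists by metis
    obtain t where "t \<in> row G h" "t \<noteq> x" "t \<noteq> m"
      using ex_not_mem_of_card[of "row G h" x m] card_row_ge_3[of h] Inc_LinesD h by blast
    then show ?thesis using h by (auto simp: row_def)
  qed
  then obtain t h where th: "\<And>m. m \<in> row G M \<Longrightarrow>
      (t m, h m) \<in> Inc G \<and> (x, h m) \<in> Inc G \<and> (m, h m) \<in> Inc G \<and> t m \<noteq> x \<and> t m \<noteq> m"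
    by metis
  have rM: "(m, M) \<in> Inc G" if "m \<in> row G M" for m using that by (simp add: row_def)
  have off: "(t m, M) \<notin> Inc G" if "m \<in> row G M" for m
    using th[OF that] rM[OF that] M(2) join_unique by metis
  \<comment> \<open>A common value of \<open>t\<close> would make two joins through \<open>x\<close>
    coincide, and that line would contain two points of \<open>M\<close>.\<close>
  have inj: "inj_on t (row G M)"
  proof (rule inj_onI, rule ccontr)
    fix m n assume mn: "m \<in> row G M" "n \<in> row G M" "t m = t n" "m \<noteq> n"
    have "h m = h n" using th[OF mn(1)] th[OF mn(2)] mn(3) join_unique by metis
    then have "h m = M" using th[OF mn(1)] th[OF mn(2)] rM[OF mn(1)] rM[OF mn(2)] mn(4) join_unique by metis
    then show False using th[OF mn(1)] M(2) by simp
  qed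
  have fin: "finite (row G M)" using card card.infinite by fastforce
  show thesis
  proof (rule that)
    have "t m \<in> Points G" if "m \<in> row G M" for m using th[OF that] Inc_PointsD by blast
    then show "insert x (t ` row G M) \<subseteq> Points (delete_line G M)"
      using x M off by (auto simp: delete_line_simps)
    have "x \<notin> t ` row G M" using th by auto
    then show "card (insert x (t ` row G M)) = 4"
      using fin card card_image[OF inj] by simp
  qed
qed

end

theorem theorem3p2:
  fixes \<Pi> :: "('p, 'l) geometry" and x :: 'p and M :: 'l
    and \<alpha>\<^sub>P :: "'p \<Rightarrow> 'p" and \<alpha>\<^sub>L :: "'l \<Rightarrow> 'l"
  assumes "projective_plane_of_order \<Pi> 2"
    and "x \<in> Points \<Pi>" and "M \<in> Lines \<Pi>" and "(x, M) \<notin> Inc \<Pi>"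
    and "automorphism \<Pi> \<alpha>\<^sub>P \<alpha>\<^sub>L" and "has_order \<Pi> \<alpha>\<^sub>P \<alpha>\<^sub>L 3"
    and "\<forall>p \<in> Points \<Pi>. \<alpha>\<^sub>P p = p \<longleftrightarrow> p = x"
    and "\<forall>l \<in> Lines \<Pi>. \<alpha>\<^sub>L l = l \<longleftrightarrow> l = M"
  defines "C \<equiv> free_completion (delete_line \<Pi> M)"
    and "\<beta> \<equiv> extend_line \<alpha>\<^sub>P \<alpha>\<^sub>L"
  shows "bij_betw \<beta> (pencil C (Point x)) (pencil C (Point x)) \<and>
    (\<exists>l \<in> pencil C (Point x). \<beta> l \<noteq> l) \<and>
    \<not> (\<exists>U \<in> Lines C. (Point x, U) \<notin> Inc C \<and>
         (\<exists>\<gamma>\<^sub>P \<gamma>\<^sub>L. automorphism C \<gamma>\<^sub>P \<gamma>\<^sub>L \<and> \<gamma>\<^sub>L U = U \<and> \<gamma>\<^sub>P (Point x) = Point x \<and>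
            (\<forall>l \<in> pencil C (Point x). \<gamma>\<^sub>L l = \<beta> l)))"
proof -
  interpret Pi: plane \<Pi>
    using assms(1) by (simp add: plane_def projective_plane_of_order_def)
  let ?G = "delete_line \<Pi> M"
  have row3: "card (row \<Pi> l) = 3" if "l \<in> Lines \<Pi>" for l
    using assms(1) that by (simp add: projective_plane_of_order_def row_def)
  have pp: "partial_plane ?G" by (rule Pi.partial_plane_delete_line)
  have rows: "finite (row ?G l) \<and> card (row ?G l) \<le> 2" if l: "l \<in> Lines ?G" for l
    using Pi.card_row_delete_line[OF assms(3) l, of 2] row3 l by (simp add: delete_line_simps)
  obtain Q where Q: "Q \<subseteq> Points ?G" "card Q = 4"
    using Pi.four_points_off_line[OF assms(2-4) row3[OF assms(3)]] by blast
  have "card {p \<in> Q. (p, l) \<in> Inc ?G} \<le> 2" if l: "l \<in> Lines ?G" for l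
  proof -
    have "card {p \<in> Q. (p, l) \<in> Inc ?G} \<le> card (row ?G l)"
      using rows[OF l] Q(1) by (intro card_mono) (auto simp: row_def)
    then show ?thesis using rows[OF l] by simp
  qed
  then have "projective_plane C"
    unfolding C_def using projective_plane_free_completion[OF pp Q] by blast
  then interpret C: unconfined_plane C
    using confined_free_completion[OF pp rows]
    by (simp add: C_def unconfined_plane_def unconfined_plane_axioms_def plane_def)
  define \<phi> where "\<phi> = extend_point \<alpha>\<^sub>P \<alpha>\<^sub>L"
  have M: "\<alpha>\<^sub>L M = M" and fx: "\<alpha>\<^sub>P x = x" using assms(2,3,7,8) by auto
  have aut0: "automorphism ?G \<alpha>\<^sub>P \<alpha>\<^sub>L" using automorphism_delete_line assms(3,5) M by metis
  then have aut: "automorphism C \<phi> \<beta>"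
    unfolding C_def \<phi>_def \<beta>_def by (rule automorphism_free_completion[OF pp])
  have x\<phi>: "\<phi> (Point x) = Point x" using fx by (simp add: \<phi>_def)
  have "Point x \<in> Points (free_stage ?G 0)"
    using assms(2,4) by (auto simp: embed_def delete_line_simps)
  then have xC: "Point x \<in> Points C" unfolding C_def Points_free_completion by blast
  have id0: "is_identity ?G (\<alpha>\<^sub>P ^^ 3) (\<alpha>\<^sub>L ^^ 3)"
    using assms(6) by (auto simp: has_order_def is_identity_def delete_line_simps)
  \<comment> \<open>The only fixed line of the Fano plane is \<open>M\<close>, which has been
    deleted, so the initial geometry has no fixed line.\<close>
  have moved: "\<beta> l \<noteq> l" if "l \<in> Lines C" for l
    using extend_line_no_fixed_line[OF id0, of x] that assms(7,8)
    by (auto simp: C_def \<beta>_def delete_line_simps)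
  have cube: "\<beta> (\<beta> (\<beta> l)) = l" if "l \<in> Lines C" for l
  proof -
    have "extend_line (\<alpha>\<^sub>P ^^ 3) (\<alpha>\<^sub>L ^^ 3) l = l"
      using is_identity_free_completion[OF id0] that by (simp add: C_def is_identity_def)
    then show ?thesis by (simp add: \<beta>_def extend_comp numeral_3_eq_3 comp_assoc)
  qed
  have pencil_iff: "\<beta> l \<in> pencil C (Point x) \<longleftrightarrow> l \<in> pencil C (Point x)" if "l \<in> Lines C" for l
    using automorphismD(2)[OF aut that] automorphismD(3)[OF aut xC that] that x\<phi>
    by (simp add: pencil_def)
  have "bij_betw \<beta> (pencil C (Point x)) (pencil C (Point x))"
  \<comment> \<open>The cube of \<open>\<beta>\<close> is the identity on lines of \<open>C\<close>,
    so its square is an explicit inverse.\<close>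
  proof (rule bij_betw_byWitness[where f' = "\<lambda>l. \<beta> (\<beta> l)"])
    have L: "l \<in> Lines C" "\<beta> l \<in> Lines C" if "l \<in> pencil C (Point x)" for l
      using that automorphismD(2)[OF aut] by (auto simp: pencil_def)
    show "\<forall>l \<in> pencil C (Point x). \<beta> (\<beta> (\<beta> l)) = l" "\<forall>l \<in> pencil C (Point x). \<beta> (\<beta> (\<beta> l)) = l"
      using cube L by blast+
    show "\<beta> ` pencil C (Point x) \<subseteq> pencil C (Point x)"
      "(\<lambda>l. \<beta> (\<beta> l)) ` pencil C (Point x) \<subseteq> pencil C (Point x)"
      using pencil_iff L by blast+
  qed
  moreover have "\<exists>l \<in> pencil C (Point x). \<beta> l \<noteq> l"
  proof -
    \<comment> \<open>Since \<open>\<beta>\<close> moves every line of \<open>C\<close>, any line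
      through \<open>x\<close> witnesses nontriviality.\<close>
    obtain l where "l \<in> pencil C (Point x)"
      using infinite_imp_nonempty[OF C.infinite_pencil[OF xC]] by blast
    then show ?thesis using moved by (auto simp: pencil_def)
  qed
  moreover have False
    if U: "U \<in> Lines C" and \<gamma>: "automorphism C \<gamma>\<^sub>P \<gamma>\<^sub>L" "\<gamma>\<^sub>L U = U" "\<gamma>\<^sub>P (Point x) = Point x"
      "\<forall>l \<in> pencil C (Point x). \<gamma>\<^sub>L l = \<beta> l" for U \<gamma>\<^sub>P \<gamma>\<^sub>L
  proof -
    \<comment> \<open>Composing with the inverse \<open>\<beta> \<circ> \<beta>\<close> of
      \<open>\<beta>\<close> turns agreement on the lines through \<open>x\<close> into fixing each
      of them. The composite then fixes \<open>U\<close> as well, and as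
      \<open>\<gamma>\<^sub>L\<close> fixes \<open>U\<close>, so does
      \<open>\<beta> \<circ> \<beta>\<close>.\<close>
    have "central_collineation C (\<phi> \<circ> \<phi> \<circ> \<gamma>\<^sub>P) (\<beta> \<circ> \<beta> \<circ> \<gamma>\<^sub>L) (Point x)"
    proof unfold_locales
      show "automorphism C (\<phi> \<circ> \<phi> \<circ> \<gamma>\<^sub>P) (\<beta> \<circ> \<beta> \<circ> \<gamma>\<^sub>L)"
        using aut \<gamma>(1) automorphism_comp by blast
      show "(\<phi> \<circ> \<phi> \<circ> \<gamma>\<^sub>P) (Point x) = Point x" using x\<phi> \<gamma>(3) by simp
      fix l assume "(Point x, l) \<in> Inc C"
      then show "(\<beta> \<circ> \<beta> \<circ> \<gamma>\<^sub>L) l = l" using C.Inc_LinesD \<gamma>(4) cube by (simp add: pencil_def)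
    qed (fact xC)
    then have "\<beta> (\<beta> U) = U" using C.central_collineation_fixes_lines U \<gamma>(2) by fastforce
    then have "\<beta> U = U" using cube[OF U] by simp
    then show False using moved U by blast
  qed
  ultimately show ?thesis by blast
qed

end
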